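(* Let $G$ be a simple connected graph (directed or undirected) on $N\ge 2$ vertices with adjacency matrix $\mathbf{A}$ and in-degree matrix $D^{in}$. Let $f:\mathbb{R}^d\to\mathbb{R}^d$ be $C^1$ with $f(0)=0$, let $\nu_1,\dots,\nu_d$ be the eigenvalues of the Jacobian $\frac{\partial f}{\partial x}(0)$, and assume $\nu_{\max}:=\max_i \operatorname{Re}(\nu_i)\neq 0$. Let $L$ be either $L^{-}=D^{in}-\mathbf{A}$ or $L^{+}=D^{in}+\mathbf{A}$, and for $\alpha\in\mathbb{R}$ consider the network system on $\mathbb{R}^{Nd}$ $$\dot{\mathbf{x}}=\mathbf{f}(\mathbf{x})+\alpha\,(L\otimes I_d)\,\mathbf{x},\qquad \mathbf{f}(\mathbf{x})=[f(x_1),\dots,f(x_N)]^T .$$ Suppose the origin is a stable equilibrium of the node dynamics $\dot x=f(x)$. Then there exists a critical coupling parameter value $\alpha_c>0$ such that the origin of the network system is (locally) exponentially stable for every $\alpha\in(-\infty,\alpha_c)$ and unstable for every $\alpha\in(\alpha_c,\infty)$.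
   Context: The adjacency matrix $\mathbf{A}$ has entries in $\{0,1\}$ and zero diagonal (simple graph: no self-loops, no multiple edges); $D^{in}=\mathrm{diag}(\mathbf{A}\mathbf{1})$, where $\mathbf{1}$ is the all-ones vector, so the in-degree of node $i$ is $\sum_j \mathbf{A}_{ij}$. A directed graph is called connected if its underlying undirected graph is connected. $\mathbf{x}=[x_1,\dots,x_N]^T$ with $x_i\in\mathbb{R}^d$. The choice $L=L^-$ corresponds to diffusive coupling ($\beta=-\alpha$) and $L=L^+$ to signless-diffusive coupling ($\beta=\alpha$) in the general linear coupling $\alpha D^{in}+\beta\mathbf{A}$. All stability notions are local and refer to the equilibrium at the origin (stable = Lyapunov stable, unstable = not Lyapunov stable). *)

theory Defs
  imports "HOL-Analysis.Analysis" "Graph_Theory.Graph_Theory"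
begin

text \<open>
  Simple graphs are loop-free digraphs without parallel arcs; an undirected graph is one whose
  arc relation is symmetric, so it is covered as a special case. The entry in row \<open>i\<close>, column \<open>j\<close>
  records an arc from \<open>j\<close> to \<open>i\<close>: with this orientation the row sums are the in-degrees.
\<close>

definition adjacency_matrix :: "('n::finite, 'e) pre_digraph \<Rightarrow> real^'n^'n" where
  "adjacency_matrix G = (\<chi> i j. if (j, i) \<in> arcs_ends G then 1 else 0)"

definition diag_matrix :: "'a::zero^'n \<Rightarrow> 'a^'n^'n" where
  "diag_matrix v = (\<chi> i j. if i = j then v $ i else 0)"

definition in_degree_matrix :: "('n::finite, 'e) pre_digraph \<Rightarrow> real^'n^'n" where
  "in_degree_matrix G = diag_matrix (adjacency_matrix G *v 1)"

lemma adjacency_matrix_mult_one: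
  fixes G :: "('n::finite, 'e) pre_digraph"
  assumes "digraph G"
  shows "(adjacency_matrix G *v 1) $ i = real (in_degree G i)"
proof -
  interpret digraph G by fact
  have "bij_betw (tail G) (in_arcs G i) {j. (j, i) \<in> arcs_ends G}"
    unfolding bij_betw_def
  proof
    show "inj_on (tail G) (in_arcs G i)"
      by (intro inj_onI no_multi_arcs) (auto simp: arc_to_ends_def)
    show "tail G ` in_arcs G i = {j. (j, i) \<in> arcs_ends G}"
      by (force simp: arcs_ends_conv)
  qed
  then have "card {j. (j, i) \<in> arcs_ends G} = in_degree G i"
    by (metis bij_betw_same_card in_degree_def)
  then show ?thesis
    by (simp add: adjacency_matrix_def matrix_vector_mult_def sum.If_cases)
qed

definition laplacian_minus :: "('n::finite, 'e) pre_digraph \<Rightarrow> real^'n^'n" where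
  "laplacian_minus G = in_degree_matrix G - adjacency_matrix G"

definition laplacian_plus :: "('n::finite, 'e) pre_digraph \<Rightarrow> real^'n^'n" where
  "laplacian_plus G = in_degree_matrix G + adjacency_matrix G"

definition kronecker_product ::
    "'a::times^'m^'n \<Rightarrow> 'a^'q^'p \<Rightarrow> 'a^('m \<times> 'q)^('n \<times> 'p)" where
  "kronecker_product A B = (\<chi> r c. A $ fst r $ fst c * B $ snd r $ snd c)"

text \<open>
  The state space \<open>\<real>\<^sup>N\<^sup>d\<close> is indexed by pairs (node, coordinate); \<open>node_state x i\<close> is the
  block of the state \<open>x\<close> that belongs to node \<open>i\<close>.
\<close>

definition node_state :: "real^('n::finite \<times> 'd::finite) \<Rightarrow> 'n \<Rightarrow> real^'d" where
  "node_state x i = (\<chi> k. x $ (i, k))"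

definition uncoupled_field ::
    "(real^'d \<Rightarrow> real^'d) \<Rightarrow> real^('n::finite \<times> 'd::finite) \<Rightarrow> real^('n \<times> 'd)" where
  "uncoupled_field f x = (\<chi> r. f (node_state x (fst r)) $ snd r)"

definition network_field ::
    "(real^'d \<Rightarrow> real^'d) \<Rightarrow> real \<Rightarrow> real^'n^'n \<Rightarrow>
      real^('n::finite \<times> 'd::finite) \<Rightarrow> real^('n \<times> 'd)" where
  "network_field f \<alpha> L x =
     uncoupled_field f x + \<alpha> *\<^sub>R (kronecker_product L (mat 1 :: real^'d^'d) *v x)"

text \<open>Complex eigenvalues of a real matrix, and the largest of their real parts.\<close>

definition eigenvalues :: "real^'n^'n \<Rightarrow> complex set" where
  "eigenvalues M = {\<nu>. \<exists>v. v \<noteq> 0 \<and> map_matrix complex_of_real M *v v = \<nu> *s v}"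

definition spectral_abscissa :: "real^'n^'n \<Rightarrow> real" where
  "spectral_abscissa M = Max (Re ` eigenvalues M)"

definition C1_field :: "(real^'d \<Rightarrow> real^'d) \<Rightarrow> bool" where
  "C1_field f \<longleftrightarrow> f differentiable_on UNIV \<and> continuous_on UNIV (\<lambda>x. jacobian f (at x))"

text \<open>
  Solutions of \<open>x' = F x\<close> that exist for all times \<open>t \<ge> 0\<close>. The stability notions below demand
  that such a solution exists for every nearby initial value. For a \<open>C\<^sup>1\<close> field, the local
  solutions with that initial value are then restrictions of it, by uniqueness.
\<close>

definition forward_solution ::
    "('a::real_normed_vector \<Rightarrow> 'a) \<Rightarrow> 'a \<Rightarrow> (real \<Rightarrow> 'a) \<Rightarrow> bool" where
  "forward_solution F x0 x \<longleftrightarrow>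
     x 0 = x0 \<and> (\<forall>t\<ge>0. (x has_vector_derivative F (x t)) (at t within {0..}))"

definition lyapunov_stable :: "('a::real_normed_vector \<Rightarrow> 'a) \<Rightarrow> 'a \<Rightarrow> bool" where
  "lyapunov_stable F p \<longleftrightarrow>
     (\<forall>\<epsilon>>0. \<exists>\<delta>>0. \<forall>x0. dist x0 p < \<delta> \<longrightarrow>
        (\<exists>x. forward_solution F x0 x) \<and>
        (\<forall>x. forward_solution F x0 x \<longrightarrow> (\<forall>t\<ge>0. dist (x t) p < \<epsilon>)))"

definition unstable :: "('a::real_normed_vector \<Rightarrow> 'a) \<Rightarrow> 'a \<Rightarrow> bool" where
  "unstable F p \<longleftrightarrow> \<not> lyapunov_stable F p"

definition locally_exponentially_stable ::
    "('a::real_normed_vector \<Rightarrow> 'a) \<Rightarrow> 'a \<Rightarrow> bool" where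
  "locally_exponentially_stable F p \<longleftrightarrow>
     (\<exists>\<delta>>0. \<exists>K>0. \<exists>\<mu>>0. \<forall>x0. dist x0 p < \<delta> \<longrightarrow>
        (\<exists>x. forward_solution F x0 x) \<and>
        (\<forall>x. forward_solution F x0 x \<longrightarrow>
           (\<forall>t\<ge>0. dist (x t) p \<le> K * exp (- \<mu> * t) * dist x0 p)))"

end

theory Submission
  imports Defs "Jordan_Normal_Form.Schur_Decomposition"
begin

text \<open>
  Both claims are read off the eigenvalues of the linearization at the origin. Let \<open>J\<close> be the Jacobian
  of \<open>f\<close> at \<open>0\<close>. The network field has the Jacobian \<open>I \<otimes> J + \<alpha> L \<otimes> I\<close>, whose eigenvalues are exactly the
  sums \<open>\<nu> + \<alpha> \<kappa>\<close> of an eigenvalue \<open>\<nu>\<close> of \<open>J\<close> and an eigenvalue \<open>\<kappa>\<close> of \<open>L\<close>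
  (\<open>eigenvalues_network_jacobian\<close>). In every row of \<open>L\<close> the diagonal entry is the in-degree, which is
  also the sum of the absolute values of the other entries. Gershgorin's discs therefore lie in the
  closed right half plane, so \<open>Re \<kappa> \<ge> 0\<close> always. The trace of \<open>L\<close> is the number of arcs, which is
  positive for a connected graph with at least two vertices, so \<open>\<rho> = max Re \<kappa> > 0\<close>
  (\<open>coupling_matrix_spectrum\<close>). A stable node has no eigenvalue with positive real part, so
  \<open>\<nu>\<^sub>m\<^sub>a\<^sub>x \<noteq> 0\<close> forces \<open>\<nu>\<^sub>m\<^sub>a\<^sub>x < 0\<close>. Hence all eigenvalues \<open>\<nu> + \<alpha> \<kappa>\<close> have negative real part when
  \<open>\<alpha> \<le> 0\<close>, while for \<open>\<alpha> \<ge> 0\<close> the largest real part is \<open>\<nu>\<^sub>m\<^sub>a\<^sub>x + \<alpha> \<rho>\<close>. It changes sign exactly once, at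
  \<open>\<alpha>\<^sub>c = - \<nu>\<^sub>m\<^sub>a\<^sub>x / \<rho>\<close>.

  What remains is Lyapunov's indirect method: the origin is exponentially stable if all eigenvalues of the
  linearization have negative real part (\<open>exponentially_stable_if_eigenvalues_negative\<close>) and
  unstable if one of them has positive real part (\<open>unstable_if_eigenvalue_positive\<close>). Both
  parts rest on one quadratic form. By Schur's theorem and a rescaling of the basis, a matrix is similar
  over the complex numbers to a diagonal matrix of eigenvalues plus an arbitrarily small error
  (\<open>nearly_diagonal_form\<close>). In such coordinates \<open>z\<close> the form \<open>\<Sum> s\<^sub>i |z\<^sub>i|\<^sup>2\<close> has, up to that error, the
  derivative \<open>2 \<Sum> s\<^sub>i Re d\<^sub>i |z\<^sub>i|\<^sup>2\<close> along the linear flow. With all \<open>s\<^sub>i = 1\<close> it is a Lyapunov function. With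
  \<open>s\<^sub>i = 1\<close> on the eigenvalues with positive real part and \<open>s\<^sub>i = - 1\<close> on the others, it grows
  exponentially wherever it is positive, so solutions that start there leave a fixed ball, however close
  to the origin they start.
  Exponential stability also asserts that solutions exist. They come from Picard's theorem
  for the globally Lipschitz field that is obtained by precomposing with the projection onto a small
  ball; as the Lyapunov function keeps its solutions inside that ball, they solve the original equation.
\<close>

no_notation vec_index (infixl "$" 100)
hide_const (open) Matrix.mat
hide_fact (open) Matrix.mat_def Matrix.vec_eq_iff

section \<open>Global solutions of Lipschitz differential equations\<close>

text \<open>
  The integral of \<open>exp (c s)\<close> is \<open>exp (c T) / c\<close> up to a constant. The factor \<open>1 / c\<close> that this leaves behind is
  what makes the Picard operator below a contraction in the norm with weight \<open>exp (- c t)\<close>.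
\<close>
lemma weighted_integral_bound:
  fixes h :: "real \<Rightarrow> 'a::banach"
  assumes "0 \<le> T" "0 < c" "0 \<le> M" and cont: "continuous_on {0..T} h"
    and bound: "\<And>s. s \<in> {0..T} \<Longrightarrow> norm (h s) \<le> M * exp (c * s)"
  shows "norm (exp (- (c * T)) *\<^sub>R integral {0..T} h) \<le> M / c"
proof -
  have "((\<lambda>s. M * exp (c * s)) has_integral (M / c * exp (c * T) - M / c * exp (c * 0))) {0..T}"
    using assms(1,2)
    by (intro fundamental_theorem_of_calculus)
       (auto intro!: derivative_eq_intros simp: has_real_derivative_iff_has_vector_derivative[symmetric])
  then have "norm (integral {0..T} h) \<le> M / c * exp (c * T) - M / c"
    using integral_norm_bound_integral[OF integrable_continuous_real[OF cont], of "\<lambda>s. M * exp (c * s)"] bound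
    by (auto simp: has_integral_iff)
  also have "\<dots> \<le> M / c * exp (c * T)"
    using assms by simp
  finally have "exp (- (c * T)) * norm (integral {0..T} h) \<le> exp (- (c * T)) * (M / c * exp (c * T))"
    by (intro mult_left_mono) auto
  also have "\<dots> = M / c"
    by (simp add: exp_minus)
  finally show ?thesis
    by simp
qed

lemma at_within_Icc_eq_atLeast:
  fixes t :: real
  assumes "0 \<le> t"
  shows "at t within {0..t+1} = at t within {0..}"
  using assms by (intro at_within_nhd[of _ "{..<t+1}"]) auto

lemma continuous_on_atLeast_if_Icc:
  fixes h :: "real \<Rightarrow> 'a::topological_space"
  assumes "\<And>T. continuous_on {0..T} h"
  shows "continuous_on {0..} h"
proof -
  have "(h \<longlongrightarrow> h t) (at t within {0..})" if "0 \<le> t" for t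
  proof -
    have "(h \<longlongrightarrow> h t) (at t within {0..t+1})"
      using assms[of "t + 1"] that by (auto simp: continuous_on_def)
    then show ?thesis
      by (simp add: at_within_Icc_eq_atLeast[OF that])
  qed
  then show ?thesis
    by (auto simp: continuous_on_def)
qed

text \<open>
  Picard iteration on the whole half-line at once. Solutions grow at most like \<open>exp (K t)\<close>, so for
  \<open>c > K\<close> the rescaled function \<open>y t = exp (- c t) x t\<close> may be sought among the bounded continuous
  functions. There the integral equation is a fixed point equation for a contraction with factor
  \<open>K / c < 1\<close>. Functions are extended to negative times by their value at \<open>0\<close>.
\<close>
lemma lipschitz_forward_solution_exists:
  fixes g :: "'a::banach \<Rightarrow> 'a"
  assumes lip: "K-lipschitz_on UNIV g"
  shows "\<exists>x. forward_solution g x0 x"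
proof -
  define c where "c = K + 1"
  have K: "0 \<le> K" and c: "0 < c" "K < c"
    using lipschitz_on_nonneg[OF lip] by (auto simp: c_def)
  have g_cont: "continuous_on S g" for S
    using lipschitz_on_continuous_on[OF lip] continuous_on_subset by blast
  define rhs where "rhs y s = g (exp (c * s) *\<^sub>R apply_bcontfun y s)" for y :: "real \<Rightarrow>\<^sub>C 'a" and s
  have rhs_cont: "continuous_on S (rhs y)" for y S
    unfolding rhs_def by (intro continuous_on_compose2[OF g_cont[of UNIV]] continuous_intros) auto
  define \<Phi> where "\<Phi> y t = exp (- (c * max 0 t)) *\<^sub>R (x0 + integral {0..max 0 t} (rhs y))" for y t
  have rhs_bound: "norm (rhs y s) \<le> (norm (g 0) + K * norm y) * exp (c * s)" if "0 \<le> s" for y s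
  proof -
    have "norm (rhs y s) \<le> norm (g 0) + norm (rhs y s - g 0)"
      by norm
    also have "norm (rhs y s - g 0) \<le> K * norm (exp (c * s) *\<^sub>R apply_bcontfun y s)"
      unfolding rhs_def
      using lipschitz_onD[OF lip, of "exp (c * s) *\<^sub>R apply_bcontfun y s" 0] by (simp add: dist_norm)
    also have "\<dots> \<le> K * (exp (c * s) * norm y)"
      using K norm_bounded[of y s] by (intro mult_left_mono) auto
    also have "norm (g 0) \<le> norm (g 0) * exp (c * s)"
      using c that by (simp add: mult_le_cancel_left1)
    finally show ?thesis
      by (simp add: algebra_simps)
  qed
  have \<Phi>_bcont: "\<Phi> y \<in> bcontfun" for y
  proof (rule bcontfun_normI)
    have "continuous_on {0..T} (\<lambda>t. integral {0..t} (rhs y))" for T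
      by (intro indefinite_integral_continuous_1 integrable_continuous_real rhs_cont)
    then have cont0: "continuous_on {0..} (\<lambda>t. integral {0..t} (rhs y))"
      by (rule continuous_on_atLeast_if_Icc)
    then show "continuous_on UNIV (\<Phi> y)"
      unfolding \<Phi>_def
      by (intro continuous_intros continuous_on_compose2[OF cont0]) auto
    fix t
    have "norm (\<Phi> y t) \<le> norm (exp (- (c * max 0 t)) *\<^sub>R x0)
        + norm (exp (- (c * max 0 t)) *\<^sub>R integral {0..max 0 t} (rhs y))"
      unfolding \<Phi>_def scaleR_add_right by (rule norm_triangle_ineq)
    also have "norm (exp (- (c * max 0 t)) *\<^sub>R x0) \<le> norm x0"
      using c by (simp add: mult_left_le_one_le zero_le_mult_iff)
    also have "norm (exp (- (c * max 0 t)) *\<^sub>R integral {0..max 0 t} (rhs y)) \<le> (norm (g 0) + K * norm y) / c"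
      using c K rhs_bound by (intro weighted_integral_bound rhs_cont) auto
    finally show "norm (\<Phi> y t) \<le> norm x0 + (norm (g 0) + K * norm y) / c"
      by simp
  qed
  define \<Psi> where "\<Psi> y = Bcontfun (\<Phi> y)" for y
  have \<Psi>_apply: "apply_bcontfun (\<Psi> y) t = \<Phi> y t" for y t
    unfolding \<Psi>_def by (simp add: Bcontfun_inverse[OF \<Phi>_bcont])
  have contraction: "dist (\<Psi> y) (\<Psi> z) \<le> K / c * dist y z" for y z
  proof (rule dist_bound)
    fix t :: real
    let ?T = "max 0 t"
    have "norm (rhs y s - rhs z s) \<le> K * dist y z * exp (c * s)" for s
    proof -
      have "norm (rhs y s - rhs z s)
          \<le> K * norm (exp (c * s) *\<^sub>R apply_bcontfun y s - exp (c * s) *\<^sub>R apply_bcontfun z s)"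
        unfolding rhs_def using lipschitz_onD[OF lip] by (simp add: dist_norm)
      also have "\<dots> = K * (exp (c * s) * dist (apply_bcontfun y s) (apply_bcontfun z s))"
        by (simp add: dist_norm scaleR_diff_right[symmetric])
      also have "\<dots> \<le> K * (exp (c * s) * dist y z)"
        using K dist_bounded[of y s z] by (intro mult_left_mono) auto
      finally show ?thesis
        by (simp add: mult_ac)
    qed
    then have "norm (exp (- (c * ?T)) *\<^sub>R integral {0..?T} (\<lambda>s. rhs y s - rhs z s)) \<le> K * dist y z / c"
      using c K by (intro weighted_integral_bound continuous_intros rhs_cont) auto
    moreover have "integral {0..?T} (\<lambda>s. rhs y s - rhs z s) = integral {0..?T} (rhs y) - integral {0..?T} (rhs z)"
      by (intro integral_diff integrable_continuous_real rhs_cont)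
    ultimately show "dist (apply_bcontfun (\<Psi> y) t) (apply_bcontfun (\<Psi> z) t) \<le> K / c * dist y z"
      by (simp add: \<Psi>_apply \<Phi>_def dist_norm algebra_simps)
  qed
  obtain y where y: "\<Psi> y = y"
    using banach_fix_type[of "K / c" \<Psi>] K c contraction by auto
  define x where "x t = exp (c * t) *\<^sub>R apply_bcontfun y t" for t
  have x_eq: "x t = x0 + integral {0..t} (\<lambda>s. g (x s))" if "0 \<le> t" for t
  proof -
    have "x t = exp (c * t) *\<^sub>R \<Phi> y t"
      unfolding x_def by (metis y \<Psi>_apply)
    then show ?thesis
      using that by (simp add: \<Phi>_def rhs_def[abs_def] x_def exp_minus)
  qed
  have "(x has_vector_derivative g (x t)) (at t within {0..})" if "0 \<le> t" for t
  proof -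
    have "((\<lambda>t. integral {0..t} (\<lambda>s. g (x s))) has_vector_derivative g (x t)) (at t within {0..t+1})"
      using that unfolding x_def
      by (intro integral_has_vector_derivative continuous_on_compose2[OF g_cont[of UNIV]] continuous_intros) auto
    then have "((\<lambda>t. x0 + integral {0..t} (\<lambda>s. g (x s))) has_vector_derivative g (x t)) (at t within {0..t+1})"
      by (auto intro!: derivative_eq_intros)
    then have "(x has_vector_derivative g (x t)) (at t within {0..t+1})"
      using that x_eq by (auto intro: has_vector_derivative_transform[rotated 2])
    then show ?thesis
      using at_within_Icc_eq_atLeast[OF that] by simp
  qed
  moreover have "x 0 = x0"
    using x_eq[of 0] by simp
  ultimately show ?thesis
    unfolding forward_solution_def by blast
qed

section \<open>Quadratic Lyapunov functions\<close>

text \<open>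
  Gronwall's inequality in differential form: \<open>V t * exp (- k t)\<close> is nondecreasing. Applied to \<open>- V\<close> it gives
  exponential decay.
\<close>
lemma exponential_comparison:
  fixes V :: "real \<Rightarrow> real"
  assumes "0 \<le> T"
    and deriv: "\<And>t. t \<in> {0..T} \<Longrightarrow> (V has_real_derivative V' t) (at t within {0..T})"
    and growth: "\<And>t. t \<in> {0..T} \<Longrightarrow> k * V t \<le> V' t"
  shows "V 0 * exp (k * T) \<le> V T"
proof -
  have "V 0 * exp (- (k * 0)) \<le> V T * exp (- (k * T))"
  proof (rule DERIV_nonneg_imp_increasing_open[OF \<open>0 \<le> T\<close>])
    show "continuous_on {0..T} (\<lambda>t. V t * exp (- (k * t)))"
      using deriv by (intro continuous_intros DERIV_continuous_on) auto
    fix t assume t: "0 < t" "t < T"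
    then have "(V has_real_derivative V' t) (at t)"
      using deriv[of t] at_within_Icc_at[of 0 t T] by auto
    then have "((\<lambda>t. V t * exp (- (k * t))) has_real_derivative (V' t - k * V t) * exp (- (k * t))) (at t)"
      by (auto intro!: derivative_eq_intros simp: algebra_simps)
    then show "\<exists>y. ((\<lambda>t. V t * exp (- (k * t))) has_real_derivative y) (at t) \<and> 0 \<le> y"
      using growth[of t] t by auto
  qed
  then have "V 0 * exp (k * T) \<le> V T * exp (- (k * T)) * exp (k * T)"
    by (intro mult_right_mono) auto
  also have "\<dots> = V T"
    by (simp add: exp_minus)
  finally show ?thesis .
qed

lemma quadratic_form_derivative:
  fixes B :: "'a::real_normed_vector \<Rightarrow> 'a \<Rightarrow> real"
  assumes "bounded_bilinear B" and sym: "\<And>x y. B x y = B y x"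
    and "forward_solution F x0 x" and "t \<in> {0..T}"
  shows "((\<lambda>t. B (x t) (x t)) has_real_derivative 2 * B (x t) (F (x t))) (at t within {0..T})"
proof -
  interpret bounded_bilinear B by fact
  have "(x has_vector_derivative F (x t)) (at t within {0..T})"
    using assms(3,4) unfolding forward_solution_def
    by (auto intro: has_vector_derivative_within_subset)
  from has_vector_derivative[OF this this] show ?thesis
    by (simp add: has_real_derivative_iff_has_vector_derivative sym[of "F (x t)"])
qed


text \<open>
  As long as the solution stays in the ball of radius \<open>r\<close>, the form \<open>B\<close> decays along it exponentially.
  If the initial value is so small that its form lies below the minimum \<open>c * r\<^sup>2\<close> that the lower bound
  guarantees on the sphere of radius \<open>r\<close>, there can be no first time at which the sphere is reached,
  so the solution is trapped and decays forever.
\<close>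
lemma quadratic_form_trapping:
  fixes B :: "'a::real_normed_vector \<Rightarrow> 'a \<Rightarrow> real"
  assumes bil: "bounded_bilinear B" and sym: "\<And>x y. B x y = B y x"
    and c: "0 < c" and lower: "\<And>x. c * (norm x)\<^sup>2 \<le> B x x"
    and upper: "\<And>x. B x x \<le> C * (norm x)\<^sup>2"
    and m: "0 < m" and r: "0 < r"
    and decay: "\<And>x. norm x \<le> r \<Longrightarrow> B x (F x) \<le> - m * B x x"
    and sol: "forward_solution F x0 x" and small: "C * (norm x0)\<^sup>2 < c * r\<^sup>2"
    and "0 \<le> t"
  shows "norm (x t) < r" and "c * (norm (x t))\<^sup>2 \<le> C * (norm x0)\<^sup>2 * exp (- (2 * m * t))"
proof -
  have x0: "x 0 = x0"
    using sol by (simp add: forward_solution_def)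
  have cont: "continuous_on {0..} x"
    using sol has_vector_derivative_continuous
    by (fastforce simp: forward_solution_def continuous_on_eq_continuous_within)
  have upto: "c * (norm (x T))\<^sup>2 \<le> C * (norm x0)\<^sup>2 * exp (- (2 * m * T))"
    if T: "0 \<le> T" and inside: "\<And>s. s \<in> {0..T} \<Longrightarrow> norm (x s) \<le> r" for T
  proof -
    have "(- B (x 0) (x 0)) * exp ((- 2 * m) * T) \<le> - B (x T) (x T)"
    proof (rule exponential_comparison[OF T])
      show "((\<lambda>s. - B (x s) (x s)) has_real_derivative - (2 * B (x s) (F (x s)))) (at s within {0..T})"
        if "s \<in> {0..T}" for s
        by (intro DERIV_minus quadratic_form_derivative[OF bil sym sol that])
      show "(- 2 * m) * (- B (x s) (x s)) \<le> - (2 * B (x s) (F (x s)))" if "s \<in> {0..T}" for s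
        using decay[OF inside[OF that]] by simp
    qed
    then have "B (x T) (x T) \<le> B x0 x0 * exp (- (2 * m * T))"
      by (simp add: x0)
    also have "\<dots> \<le> C * (norm x0)\<^sup>2 * exp (- (2 * m * T))"
      using upper by (intro mult_right_mono) auto
    finally show ?thesis
      using lower[of "x T"] by linarith
  qed
  have strict: "norm (x T) < r" if T: "0 \<le> T" and inside: "\<And>s. s \<in> {0..T} \<Longrightarrow> norm (x s) \<le> r" for T
  proof -
    have "0 \<le> C * (norm x0)\<^sup>2"
      using lower[of x0] upper[of x0] c by (smt (verit) mult_nonneg_nonneg zero_le_power2)
    then have "C * (norm x0)\<^sup>2 * exp (- (2 * m * T)) \<le> C * (norm x0)\<^sup>2"
      using T m by (simp add: mult_right_le_one_le)
    then have "c * (norm (x T))\<^sup>2 < c * r\<^sup>2"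
      using upto[OF T inside] small by linarith
    then show ?thesis
      using c r by (simp add: power2_less_imp_less)
  qed
  have inside: "norm (x s) < r" if "0 \<le> s" for s
  proof (rule ccontr)
    assume "\<not> norm (x s) < r"
    \<comment> \<open>\<open>Inf S\<close> is the first time at which the solution touches the sphere.\<close>
    define S where "S = {s \<in> {0..}. r \<le> norm (x s)}"
    have "closed S"
      unfolding S_def by (intro continuous_on_closed_Collect_le continuous_intros cont)
    moreover have "s \<in> S" and bdd: "bdd_below S"
      using that \<open>\<not> norm (x s) < r\<close> by (auto simp: S_def intro: bdd_belowI[of _ 0])
    ultimately have T: "Inf S \<in> S"
      by (intro closed_contains_Inf) auto
    have before: "norm (x u) < r" if "u \<in> {0..<Inf S}" for u
      using that cInf_lower[OF _ bdd, of u] by (force simp: S_def)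
    have "c * (norm x0)\<^sup>2 < c * r\<^sup>2"
      using lower[of x0] upper[of x0] small by linarith
    then have start: "norm x0 < r"
      using c r by (simp add: power2_less_imp_less)
    have pos: "0 < Inf S"
      using T start x0 by (auto simp: S_def order.order_iff_strict)
    have "norm (x u) \<le> r" if "u \<in> {0..Inf S}" for u
      using continuous_on_closure_norm_le[of "{0..<Inf S}" x r u] before pos that continuous_on_subset[OF cont]
      by (auto simp: closure_atLeastLessThan less_imp_le)
    then have "norm (x (Inf S)) < r"
      using pos by (intro strict) auto
    with T show False
      by (simp add: S_def)
  qed
  show "norm (x t) < r" "c * (norm (x t))\<^sup>2 \<le> C * (norm x0)\<^sup>2 * exp (- (2 * m * t))"
    using inside upto \<open>0 \<le> t\<close> by (auto simp: less_imp_le)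
qed

text \<open>
  Near the origin the derivative of a quadratic form along \<open>F\<close> differs from the one along the
  linearization by an arbitrarily small multiple of \<open>(norm x)\<^sup>2\<close>. A form with a strict rate of
  decay or growth for the linear equation therefore serves for the nonlinear one as well.
\<close>
lemma linearization_error:
  fixes F :: "'a::real_normed_vector \<Rightarrow> 'a" and B :: "'a \<Rightarrow> 'a \<Rightarrow> real"
  assumes "bounded_bilinear B" and "(F has_derivative A) (at 0)" and "F 0 = 0" and "0 < e"
  obtains \<delta> where "0 < \<delta>" "\<And>x. norm x < \<delta> \<Longrightarrow> \<bar>B x (F x) - B x (A x)\<bar> \<le> e * (norm x)\<^sup>2"
proof -
  interpret bounded_bilinear B by fact
  obtain b where b: "0 < b" "\<And>x y. norm (B x y) \<le> norm x * norm y * b"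
    using pos_bounded by blast
  obtain \<delta> where \<delta>: "0 < \<delta>" "\<And>x. norm x < \<delta> \<Longrightarrow> norm (F x - A x) \<le> e / b * norm x"
    using assms(2-4) b(1) unfolding has_derivative_at_alt
    by (metis diff_zero divide_pos_pos)
  have "\<bar>B x (F x) - B x (A x)\<bar> \<le> e * (norm x)\<^sup>2" if "norm x < \<delta>" for x
  proof -
    have "\<bar>B x (F x) - B x (A x)\<bar> \<le> norm x * norm (F x - A x) * b"
      using b(2)[of x "F x - A x"] by (simp add: diff_right)
    also have "\<dots> \<le> norm x * (e / b * norm x) * b"
      using \<delta>(2)[OF that] b(1) by (intro mult_right_mono mult_left_mono) auto
    also have "\<dots> = e * (norm x)\<^sup>2"
      using b(1) by (simp add: power2_eq_square)
    finally show ?thesis .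
  qed
  with \<delta>(1) that show thesis by blast
qed

text \<open>
  Lyapunov's direct method with existence of solutions. Precomposing \<open>F\<close> with the closest-point
  projection onto a small ball gives a globally Lipschitz field, which has global solutions. By
  \<open>quadratic_form_trapping\<close> those that start close enough to the origin never leave the ball,
  so they solve the original equation; the same lemma gives the decay of every solution of that equation.
\<close>
lemma exponentially_stable_if_negative_form:
  fixes F :: "'a::euclidean_space \<Rightarrow> 'a" and B :: "'a \<Rightarrow> 'a \<Rightarrow> real"
  assumes F: "(F has_derivative A) (at 0)" "F 0 = 0"
    and lip: "K-lipschitz_on (cball 0 r0) F" "0 < r0"
    and bil: "bounded_bilinear B" and sym: "\<And>x y. B x y = B y x"
    and c: "0 < c" and lower: "\<And>x. c * (norm x)\<^sup>2 \<le> B x x"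
    and \<mu>: "0 < \<mu>" and neg: "\<And>x. B x (A x) \<le> - \<mu> * (norm x)\<^sup>2"
  shows "locally_exponentially_stable F 0"
proof -
  interpret bounded_bilinear B by fact
  obtain b where b: "0 < b" "\<And>x y. norm (B x y) \<le> norm x * norm y * b"
    using pos_bounded by blast
  have upper: "B x x \<le> b * (norm x)\<^sup>2" for x
    using b(2)[of x x] by (simp add: power2_eq_square mult_ac)
  obtain \<delta> where \<delta>: "0 < \<delta>" "\<And>x. norm x < \<delta> \<Longrightarrow> \<bar>B x (F x) - B x (A x)\<bar> \<le> \<mu> / 2 * (norm x)\<^sup>2"
    using linearization_error[OF bil F, of "\<mu> / 2"] \<mu> by auto
  define r where "r = min r0 (\<delta> / 2)"
  define m where "m = \<mu> / (2 * b)"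
  have r: "0 < r" "r \<le> r0" "r < \<delta>" and m: "0 < m"
    using lip(2) \<delta>(1) \<mu> b(1) by (auto simp: r_def m_def)
  have decay: "B x (F x) \<le> - m * B x x" if "norm x \<le> r" for x
  proof -
    have "B x (F x) \<le> - (\<mu> / 2) * (norm x)\<^sup>2"
      using \<delta>(2)[of x] neg[of x] that r unfolding abs_le_iff by linarith
    also have "\<dots> = - m * (b * (norm x)\<^sup>2)"
      using b(1) by (simp add: m_def)
    also have "\<dots> \<le> - m * B x x"
      using upper[of x] m by simp
    finally show ?thesis .
  qed
  define g where "g = F \<circ> closest_point (cball 0 r)"
  have "K-lipschitz_on UNIV g"
  proof (rule lipschitz_onI)
    show "0 \<le> K"
      using lip(1) by (rule lipschitz_on_nonneg)
    fix x y
    have "closest_point (cball 0 r) z \<in> cball 0 r0" for z :: 'a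
      using closest_point_in_set[of "cball 0 r" z] r by auto
    then have "dist (g x) (g y) \<le> K * dist (closest_point (cball 0 r) x) (closest_point (cball 0 r) y)"
      unfolding g_def by (auto intro: lipschitz_onD[OF lip(1)])
    also have "\<dots> \<le> K * dist x y"
      using r \<open>0 \<le> K\<close> by (intro mult_left_mono closest_point_lipschitz) auto
    finally show "dist (g x) (g y) \<le> K * dist x y" .
  qed
  have g_eq: "g x = F x" if "norm x \<le> r" for x
    using that by (simp add: g_def closest_point_self)
  \<comment> \<open>A start in the ball of radius \<open>d\<close> has a form below \<open>b d\<^sup>2 = c r\<^sup>2\<close>, as trapping requires.\<close>
  define d where "d = r * sqrt (c / b)"
  have d: "0 < d"
    using r c b by (simp add: d_def)
  have small: "b * (norm x0)\<^sup>2 < c * r\<^sup>2" if "dist x0 0 < d" for x0 :: 'a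
  proof -
    have "(norm x0)\<^sup>2 < d\<^sup>2"
      using that by (intro power_strict_mono) auto
    also have "\<dots> = r\<^sup>2 * (c / b)"
      using c b by (simp add: d_def power_mult_distrib)
    finally show ?thesis
      using b by (simp add: field_simps)
  qed
  have "\<exists>x. forward_solution F x0 x" if near: "dist x0 0 < d" for x0
  proof -
    obtain y where y: "forward_solution g x0 y"
      using lipschitz_forward_solution_exists[OF \<open>K-lipschitz_on UNIV g\<close>] by blast
    have "norm (y t) < r" if "0 \<le> t" for t
      by (rule quadratic_form_trapping(1)[OF bil sym c lower upper m r(1) _ y small[OF near] that])
         (use decay in \<open>simp add: g_eq\<close>)
    then have "forward_solution F x0 y"
      using y by (simp add: forward_solution_def g_eq less_imp_le)
    then show ?thesis
      by blast
  qed
  moreover have "dist (x t) 0 \<le> sqrt (b / c) * exp (- m * t) * dist x0 0"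
    if near: "dist x0 0 < d" and sol: "forward_solution F x0 x" and "0 \<le> t" for x0 x t
  proof -
    have "c * (norm (x t))\<^sup>2 \<le> b * (norm x0)\<^sup>2 * exp (- (2 * m * t))"
      by (rule quadratic_form_trapping(2)[OF bil sym c lower upper m r(1) decay sol small[OF near] \<open>0 \<le> t\<close>])
    then have "(norm (x t))\<^sup>2 \<le> b / c * (norm x0)\<^sup>2 * exp (- (2 * m * t))"
      using c by (simp add: field_simps)
    also have "\<dots> = (sqrt (b / c) * exp (- m * t) * norm x0)\<^sup>2"
      using b c by (simp add: power_mult_distrib exp_double[symmetric] mult_ac)
    finally show ?thesis
      using b c by (auto intro: power2_le_imp_le)
  qed
  ultimately show ?thesis
    unfolding locally_exponentially_stable_def
    using d m b c
    by - (rule exI[of _ d], rule conjI, assumption, rule exI[of _ "sqrt (b / c)"], rule conjI, simp,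
        rule exI[of _ m], blast)
qed

text \<open>
  Chetaev's argument. The form may be indefinite, but it grows exponentially along every solution that starts where
  it is positive and stays near the origin. Such starting points exist arbitrarily close to the origin,
  as the form is homogeneous. Stability would provide a solution from there that remains in a ball, on
  which the form is bounded.
\<close>
lemma unstable_if_expanding_form:
  fixes F :: "'a::real_normed_vector \<Rightarrow> 'a" and B :: "'a \<Rightarrow> 'a \<Rightarrow> real"
  assumes F: "(F has_derivative A) (at 0)" "F 0 = 0"
    and bil: "bounded_bilinear B" and sym: "\<And>x y. B x y = B y x"
    and \<sigma>: "0 < \<sigma>" and \<eta>: "0 < \<eta>"
    and expanding: "\<And>x. \<sigma> * B x x + \<eta> * (norm x)\<^sup>2 \<le> B x (A x)"
    and v: "0 < B v v"
  shows "unstable F 0"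
  unfolding unstable_def
proof
  assume stable: "lyapunov_stable F 0"
  interpret bounded_bilinear B by fact
  obtain b where b: "0 < b" "\<And>x y. norm (B x y) \<le> norm x * norm y * b"
    using pos_bounded by blast
  obtain r where r: "0 < r" "\<And>x. norm x < r \<Longrightarrow> \<bar>B x (F x) - B x (A x)\<bar> \<le> \<eta> * (norm x)\<^sup>2"
    using linearization_error[OF bil F \<eta>] by auto
  obtain \<delta> where \<delta>: "0 < \<delta>" "\<And>x0. dist x0 0 < \<delta> \<Longrightarrow> \<exists>x. forward_solution F x0 x"
    "\<And>x0 x t. dist x0 0 < \<delta> \<Longrightarrow> forward_solution F x0 x \<Longrightarrow> 0 \<le> t \<Longrightarrow> dist (x t) 0 < r"
    using stable r(1) unfolding lyapunov_stable_def by metis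
  define x0 where "x0 = (\<delta> / (2 * norm v)) *\<^sub>R v"
  have "v \<noteq> 0"
    using v zero_left by auto
  then have near: "dist x0 0 < \<delta>" and pos: "0 < B x0 x0"
    using \<delta>(1) v by (simp_all add: x0_def scaleR_left scaleR_right)
  obtain x where x: "forward_solution F x0 x"
    using \<delta>(2)[OF near] by blast
  have inside: "norm (x t) < r" if "0 \<le> t" for t
    using \<delta>(3)[OF near x that] by simp
  have growth: "B x0 x0 * exp (2 * \<sigma> * T) \<le> b * r\<^sup>2" if T: "0 \<le> T" for T
  proof -
    have "B (x 0) (x 0) * exp (2 * \<sigma> * T) \<le> B (x T) (x T)"
    proof (rule exponential_comparison[OF T])
      show "((\<lambda>t. B (x t) (x t)) has_real_derivative 2 * B (x t) (F (x t))) (at t within {0..T})"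
        if "t \<in> {0..T}" for t
        by (rule quadratic_form_derivative[OF bil sym x that])
      show "2 * \<sigma> * B (x t) (x t) \<le> 2 * B (x t) (F (x t))" if "t \<in> {0..T}" for t
        using r(2)[OF inside[of t]] expanding[of "x t"] that by (auto simp: abs_le_iff)
    qed
    also have "\<dots> \<le> norm (x T) * norm (x T) * b"
      using b(2)[of "x T" "x T"] by simp
    also have "\<dots> \<le> r * r * b"
      using inside[OF T] b(1) r(1) by (intro mult_right_mono mult_mono) auto
    finally show ?thesis
      using x by (simp add: forward_solution_def power2_eq_square mult_ac)
  qed
  \<comment> \<open>A time at which the first-order lower bound \<open>exp s \<ge> 1 + s\<close> already exceeds the bound \<open>b r\<^sup>2\<close>.\<close>
  define T where "T = b * r\<^sup>2 / (B x0 x0 * (2 * \<sigma>))"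
  have "b * r\<^sup>2 = B x0 x0 * (2 * \<sigma> * T)"
    using pos \<sigma> by (simp add: T_def)
  also have "\<dots> < B x0 x0 * (1 + 2 * \<sigma> * T)"
    using pos by simp
  also have "\<dots> \<le> B x0 x0 * exp (2 * \<sigma> * T)"
    using pos by (intro mult_left_mono exp_ge_add_one_self) auto
  also have "\<dots> \<le> b * r\<^sup>2"
    using b(1) pos \<sigma> by (intro growth) (auto simp: T_def)
  finally show False
    by simp
qed

section \<open>Nearly diagonal forms of matrices\<close>

text \<open>
  Schur's theorem, together with the fact that the diagonal of the triangular matrix is the spectrum,
  for matrices over an arbitrary finite index type. Such a type has no order of its own, so the
  injection \<open>k\<close> into the natural numbers says in which order of the indices \<open>T\<close> is upper triangular.
\<close>
lemma complex_schur_form: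
  fixes A :: "complex^'n::finite^'n"
  obtains P Q T :: "complex^'n^'n" and k :: "'n \<Rightarrow> nat"
  where "P ** Q = mat 1" and "Q ** P = mat 1" and "A = P ** T ** Q"
    and "inj k" and "\<And>i j. k j < k i \<Longrightarrow> T $ i $ j = 0"
    and "range (\<lambda>i. T $ i $ i) = {\<nu>. \<exists>v. v \<noteq> 0 \<and> A *v v = \<nu> *s v}"
proof -
  define N where "N = CARD('n)"
  obtain k :: "'n \<Rightarrow> nat" where k: "bij_betw k UNIV {0..<N}"
    using ex_bij_betw_finite_nat[of "UNIV :: 'n set"] by (auto simp: N_def)
  define e where "e = inv_into UNIV k"
  have k_less: "k i < N" and e_k: "e (k i) = i" for i
    using k by (auto simp: bij_betw_def e_def)
  have k_e: "k (e l) = l" if "l < N" for l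
    using that k by (auto simp: bij_betw_def e_def intro!: f_inv_into_f)
  have k_inj: "k i = k j \<longleftrightarrow> i = j" for i j
    by (metis e_k)
  have reindex: "(\<Sum>l = 0..<N. h l) = (\<Sum>i\<in>UNIV. h (k i))" for h :: "nat \<Rightarrow> complex"
    using sum.reindex_bij_betw[OF k, of h] by simp
  \<comment> \<open>\<open>J\<close> and \<open>H\<close> translate between index types and the index range \<open>{0..<N}\<close>;
    \<open>H\<close> is multiplicative, so it carries the factorization over.\<close>
  define J where "J = Matrix.mat N N (\<lambda>(i, j). A $ e i $ e j)"
  define H :: "complex Matrix.mat \<Rightarrow> complex^'n^'n" where "H B = (\<chi> i j. B $$ (k i, k j))" for B
  have H_mult: "H (B * C) = H B ** H C" if "B \<in> carrier_mat N N" "C \<in> carrier_mat N N" for B C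
    using that k_less
    by (auto simp: H_def vec_eq_iff matrix_matrix_mult_def scalar_prod_def reindex)
  have H_one: "H (1\<^sub>m N) = mat 1"
    using k_less by (auto simp: H_def vec_eq_iff mat_def k_inj)
  have J: "J \<in> carrier_mat N N" and H_J: "H J = A"
    using k_less by (auto simp: J_def H_def vec_eq_iff e_k)
  obtain es where es: "char_poly J = (\<Prod>a\<leftarrow>es. [:- a, 1:])"
    using char_poly_factorized[OF J] by blast
  obtain T P Q where schur: "schur_decomposition J es = (T, P, Q)"
    by (cases "schur_decomposition J es") auto
  have wit: "similar_mat_wit J T P Q" and tri: "upper_triangular T" and diag: "diag_mat T = es"
    using schur_decomposition[OF J es schur] by auto
  note PQ = similar_mat_witD2[OF J wit]
  have "{\<nu>. \<exists>v. v \<noteq> 0 \<and> A *v v = \<nu> *s v} = {\<nu>. eigenvalue J \<nu>}"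
  proof (intro subset_antisym subsetI)
    fix \<nu> assume "\<nu> \<in> {\<nu>. \<exists>v. v \<noteq> 0 \<and> A *v v = \<nu> *s v}"
    then obtain v where v: "v \<noteq> 0" "A *v v = \<nu> *s v"
      by blast
    define w where "w = Matrix.vec N (\<lambda>l. v $ e l)"
    have "w \<noteq> 0\<^sub>v N"
    proof
      assume "w = 0\<^sub>v N"
      then have "vec_index w (k i) = 0" for i
        using k_less by simp
      then have "v = 0"
        using k_less by (simp add: w_def e_k vec_eq_iff)
      with v show False by simp
    qed
    moreover have "J *\<^sub>v w = \<nu> \<cdot>\<^sub>v w"
    proof (rule eq_vecI)
      fix l assume "l < dim_vec (\<nu> \<cdot>\<^sub>v w)"
      then have l: "l < N" by (simp add: w_def)
      have "(A *v v) $ e l = \<nu> * v $ e l"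
        using v by simp
      with l k_less show "vec_index (J *\<^sub>v w) l = vec_index (\<nu> \<cdot>\<^sub>v w) l"
        by (simp add: J_def w_def scalar_prod_def reindex matrix_vector_mult_def e_k)
    qed (simp add: J_def w_def)
    ultimately show "\<nu> \<in> {\<nu>. eigenvalue J \<nu>}"
      unfolding mem_Collect_eq eigenvalue_def eigenvector_def by (intro exI[of _ w]) (simp add: J_def w_def)
  next
    fix \<nu> assume "\<nu> \<in> {\<nu>. eigenvalue J \<nu>}"
    then obtain w where w: "w \<in> carrier_vec N" "w \<noteq> 0\<^sub>v N" "J *\<^sub>v w = \<nu> \<cdot>\<^sub>v w"
      using J unfolding eigenvalue_def eigenvector_def by auto
    define v :: "complex^'n" where "v = (\<chi> i. vec_index w (k i))"
    have "v \<noteq> 0"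
    proof
      assume "v = 0"
      then have "v $ e l = 0" for l
        by simp
      then have "vec_index w l = 0" if "l < N" for l
        using k_e[OF that] unfolding v_def by (metis vec_lambda_beta)
      then have "w = 0\<^sub>v N"
        using w(1) by (intro eq_vecI) auto
      with w show False by simp
    qed
    moreover have "A *v v = \<nu> *s v"
    proof (simp only: vec_eq_iff, rule allI)
      fix i
      have "vec_index (J *\<^sub>v w) (k i) = vec_index (\<nu> \<cdot>\<^sub>v w) (k i)"
        using w by simp
      with w(1) k_less[of i] k_less show "(A *v v) $ i = (\<nu> *s v) $ i"
        by (simp add: J_def v_def scalar_prod_def reindex matrix_vector_mult_def e_k)
    qed
    ultimately show "\<nu> \<in> {\<nu>. \<exists>v. v \<noteq> 0 \<and> A *v v = \<nu> *s v}"
      by blast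
  qed
  also have "\<dots> = set es"
    by (auto simp: eigenvalue_root_char_poly[OF J] es linear_poly_root poly_prod_list prod_list_zero_iff)
  also have "\<dots> = (\<lambda>l. T $$ (l, l)) ` {0..<N}"
    using diag[symmetric] PQ(5) by (auto simp: diag_mat_def)
  also have "\<dots> = range (\<lambda>i. T $$ (k i, k i))"
    unfolding bij_betw_imp_surj_on[OF k, symmetric] by (simp only: image_image)
  finally have eig: "range (\<lambda>i. H T $ i $ i) = {\<nu>. \<exists>v. v \<noteq> 0 \<and> A *v v = \<nu> *s v}"
    by (simp add: H_def)
  show thesis
  proof (rule that)
    show "H P ** H Q = mat 1" "H Q ** H P = mat 1"
      using PQ(1,2,6,7) by (simp_all add: H_mult[symmetric] H_one)
    have "A = H (P * T * Q)"
      using H_J PQ(3) by simp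
    also have "\<dots> = H P ** H T ** H Q"
      using PQ(5-7) by (simp add: H_mult mult_carrier_mat[of _ N N] matrix_mul_assoc)
    finally show "A = H P ** H T ** H Q" .
    show "inj k"
      using k by (simp add: bij_betw_def)
    show "H T $ i $ j = 0" if "k j < k i" for i j
      using upper_triangularD[OF tri that] k_less[of i] PQ(5) by (simp add: H_def)
  qed (rule eig)
qed

lemma diag_matrix_mult_nth: "(diag_matrix u ** M) $ i $ j = u $ i * M $ i $ j"
  for u :: "'a::semiring_1^'n::finite"
  by (simp add: diag_matrix_def matrix_matrix_mult_def mult_delta_left)

lemma mult_diag_matrix_nth: "(M ** diag_matrix u) $ i $ j = M $ i $ j * u $ j"
  for u :: "'a::semiring_1^'n::finite"
  by (simp add: diag_matrix_def matrix_matrix_mult_def mult_delta_right)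

text \<open>
  Conjugating an upper triangular matrix by the diagonal matrix with entries \<open>\<delta> ^ k i\<close> multiplies the entry in
  row \<open>i\<close> and column \<open>j\<close> by \<open>\<delta> ^ (k j - k i)\<close>. The diagonal is unchanged and everything above it shrinks
  with \<open>\<delta>\<close>. This replaces the Jordan form: for estimates it is as good as diagonalizability.
\<close>
lemma nearly_diagonal_form:
  fixes M :: "real^'n::finite^'n"
  assumes \<epsilon>: "0 < \<epsilon>"
  obtains P Q :: "complex^'n^'n" and d :: "'n \<Rightarrow> complex"
  where "P ** Q = mat 1" and "Q ** P = mat 1" and "\<And>i. d i \<in> eigenvalues M"
    and "\<And>i j. norm ((Q ** map_matrix complex_of_real M ** P) $ i $ j - (if i = j then d i else 0)) < \<epsilon>"
proof -
  define A where "A = map_matrix complex_of_real M"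
  obtain P Q T :: "complex^'n^'n" and k :: "'n \<Rightarrow> nat" where PQ: "P ** Q = mat 1" "Q ** P = mat 1"
    and A: "A = P ** T ** Q" and k: "inj k" and tri: "\<And>i j. k j < k i \<Longrightarrow> T $ i $ j = 0"
    and eig: "range (\<lambda>i. T $ i $ i) = {\<nu>. \<exists>v. v \<noteq> 0 \<and> A *v v = \<nu> *s v}"
    using complex_schur_form by blast
  define C where "C = (\<Sum>i\<in>UNIV. \<Sum>j\<in>UNIV. norm (T $ i $ j))"
  have T_le: "norm (T $ i $ j) \<le> C" for i j
  proof -
    have "norm (T $ i $ j) \<le> (\<Sum>j\<in>UNIV. norm (T $ i $ j))"
      by (rule member_le_sum) auto
    also have "\<dots> \<le> C"
      unfolding C_def by (rule member_le_sum[of _ UNIV "\<lambda>i. \<Sum>j\<in>UNIV. norm (T $ i $ j)"]) (auto intro: sum_nonneg)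
    finally show ?thesis .
  qed
  have C: "0 \<le> C"
    unfolding C_def by (intro sum_nonneg) auto
  define \<delta> where "\<delta> = min 1 (\<epsilon> / (C + 1))"
  have \<delta>: "0 < \<delta>" "\<delta> \<le> 1" "\<delta> * C < \<epsilon>"
  proof -
    show "0 < \<delta>" "\<delta> \<le> 1"
      using \<epsilon> C by (auto simp: \<delta>_def)
    have "\<delta> * C \<le> \<epsilon> / (C + 1) * C"
      using C by (intro mult_right_mono) (auto simp: \<delta>_def)
    also have "\<dots> < \<epsilon>"
      using \<epsilon> C by (simp add: field_simps)
    finally show "\<delta> * C < \<epsilon>" .
  qed
  define R S :: "complex^'n^'n" where "R = diag_matrix (\<chi> i. of_real \<delta> ^ k i)"
    and "S = diag_matrix (\<chi> i. inverse (of_real \<delta> ^ k i))"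
  have RS: "R ** S = mat 1" "S ** R = mat 1"
    using \<delta>(1) by (simp_all add: vec_eq_iff R_def diag_matrix_mult_nth mult_diag_matrix_nth S_def)
      (simp_all add: diag_matrix_def mat_def)
  have "(P ** R) ** (S ** Q) = P ** (R ** S) ** Q" "(S ** Q) ** (P ** R) = S ** (Q ** P) ** R"
    "(S ** Q) ** A ** (P ** R) = S ** (Q ** P) ** T ** (Q ** P) ** R"
    by (simp_all only: A matrix_mul_assoc)
  then have conj: "(P ** R) ** (S ** Q) = mat 1" "(S ** Q) ** (P ** R) = mat 1"
    "(S ** Q) ** A ** (P ** R) = S ** T ** R"
    by (simp_all add: PQ RS)
  have close: "norm ((S ** T ** R) $ i $ j - (if i = j then T $ i $ i else 0)) < \<epsilon>" for i j
  proof -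
    have entry: "(S ** T ** R) $ i $ j = inverse (of_real \<delta> ^ k i) * T $ i $ j * of_real \<delta> ^ k j"
      by (simp add: R_def S_def diag_matrix_mult_nth mult_diag_matrix_nth)
    consider "i = j" | "k j < k i" | "k i < k j"
      using injD[OF k, of i j] by (cases "k i" "k j" rule: linorder_cases) auto
    then show ?thesis
    proof cases
      case 1
      then show ?thesis
        using \<epsilon> \<delta>(1) entry by (simp add: field_simps)
    next
      case 2
      then show ?thesis
        using \<epsilon> tri by (auto simp: entry)
    next
      case 3
      then have "\<delta> ^ k j = \<delta> ^ k i * \<delta> ^ (k j - k i)"
        by (metis le_add_diff_inverse less_imp_le power_add)
      then have "norm ((S ** T ** R) $ i $ j) = \<delta> ^ (k j - k i) * norm (T $ i $ j)"
        using \<delta>(1) unfolding entry by (simp add: norm_mult norm_inverse norm_power)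
      also have "\<dots> \<le> \<delta> ^ 1 * C"
        using \<delta> 3 T_le C by (intro mult_mono power_decreasing) auto
      finally show ?thesis
        using 3 \<delta>(3) by (auto split: if_splits)
    qed
  qed
  have "T $ i $ i \<in> eigenvalues M" for i
    using eig unfolding eigenvalues_def A_def by blast
  from that[OF conj(1,2) this close[folded conj(3), unfolded A_def]] show thesis .
qed

lemma finite_eigenvalues: "finite (eigenvalues M)" and eigenvalues_nonempty: "eigenvalues M \<noteq> {}"
  for M :: "real^'n::finite^'n"
proof -
  obtain T :: "complex^'n^'n" where
    "range (\<lambda>i. T $ i $ i) = {\<nu>. \<exists>v. v \<noteq> 0 \<and> map_matrix complex_of_real M *v v = \<nu> *s v}"
    by (rule complex_schur_form[of "map_matrix complex_of_real M"]) (rule that)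
  then have "eigenvalues M = range (\<lambda>i. T $ i $ i)"
    unfolding eigenvalues_def by (rule sym)
  then show "finite (eigenvalues M)" "eigenvalues M \<noteq> {}"
    by simp_all
qed

lemma norm_square_vec: "(norm z)\<^sup>2 = (\<Sum>i\<in>UNIV. (norm (z $ i))\<^sup>2)"
  for z :: "'a::real_inner^'n::finite"
  by (simp add: power2_norm_eq_inner inner_vec_def)

text \<open>
  The diagonal part \<open>d\<close> of \<open>W\<close> contributes the second sum exactly; each entry of the remainder is at
  most \<open>\<epsilon>\<close> in modulus, and \<open>|z\<^sub>i| |z\<^sub>j| \<le> (|z\<^sub>i|\<^sup>2 + |z\<^sub>j|\<^sup>2) / 2\<close> turns the cross terms into squares.
\<close>
lemma nearly_diagonal_estimate:
  fixes W :: "complex^'n::finite^'n" and z :: "complex^'n" and s :: "'n \<Rightarrow> real"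
  assumes W: "\<And>i j. norm (W $ i $ j - (if i = j then d i else 0)) \<le> \<epsilon>"
    and s: "\<And>i. \<bar>s i\<bar> \<le> 1"
  shows "\<bar>(\<Sum>i\<in>UNIV. s i * (z $ i \<bullet> (W *v z) $ i)) - (\<Sum>i\<in>UNIV. s i * Re (d i) * (norm (z $ i))\<^sup>2)\<bar>
    \<le> \<epsilon> * CARD('n) * (norm z)\<^sup>2"
proof -
  define E where "E i j = W $ i $ j - (if i = j then d i else 0)" for i j
  have \<epsilon>: "0 \<le> \<epsilon>"
    using W[of undefined undefined] norm_ge_zero order_trans by blast
  have row: "z $ i \<bullet> (W *v z) $ i = Re (d i) * (norm (z $ i))\<^sup>2 + (\<Sum>j\<in>UNIV. z $ i \<bullet> (E i j * z $ j))" for i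
  proof -
    have "(W *v z) $ i = (\<Sum>j\<in>UNIV. (if i = j then d i * z $ j else 0) + E i j * z $ j)"
      unfolding matrix_vector_mult_def E_def by (auto simp: algebra_simps intro!: sum.cong)
    also have "\<dots> = d i * z $ i + (\<Sum>j\<in>UNIV. E i j * z $ j)"
      by (simp add: sum.distrib)
    moreover have "z $ i \<bullet> (d i * z $ i) = Re (d i) * (norm (z $ i))\<^sup>2"
      unfolding cmod_power2 inner_complex_def by (simp add: algebra_simps power2_eq_square)
    ultimately show ?thesis
      by (simp add: inner_add_right inner_sum_right)
  qed
  have "\<bar>\<Sum>i\<in>UNIV. s i * (\<Sum>j\<in>UNIV. z $ i \<bullet> (E i j * z $ j))\<bar>
      \<le> (\<Sum>i\<in>UNIV. \<Sum>j\<in>UNIV. \<epsilon> * (((norm (z $ i))\<^sup>2 + (norm (z $ j))\<^sup>2) / 2))"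
  proof (rule order_trans[OF sum_abs], rule sum_mono)
    fix i
    have "\<bar>s i * (\<Sum>j\<in>UNIV. z $ i \<bullet> (E i j * z $ j))\<bar> \<le> 1 * (\<Sum>j\<in>UNIV. \<bar>z $ i \<bullet> (E i j * z $ j)\<bar>)"
      unfolding abs_mult by (intro mult_mono s sum_abs) auto
    also have "\<dots> \<le> (\<Sum>j\<in>UNIV. \<epsilon> * (((norm (z $ i))\<^sup>2 + (norm (z $ j))\<^sup>2) / 2))"
      unfolding mult_1
    proof (rule sum_mono)
      fix j
      have "\<bar>z $ i \<bullet> (E i j * z $ j)\<bar> \<le> norm (z $ i) * (norm (E i j) * norm (z $ j))"
        using Cauchy_Schwarz_ineq2[of "z $ i" "E i j * z $ j"] by (simp add: norm_mult)
      also have "\<dots> \<le> norm (z $ i) * (\<epsilon> * norm (z $ j))"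
        unfolding E_def by (intro mult_left_mono mult_right_mono W) auto
      also have "\<dots> = \<epsilon> * (norm (z $ i) * norm (z $ j))"
        by simp
      also have "\<dots> \<le> \<epsilon> * (((norm (z $ i))\<^sup>2 + (norm (z $ j))\<^sup>2) / 2)"
        using \<epsilon> sum_squares_bound[of "norm (z $ i)" "norm (z $ j)"] by (intro mult_left_mono) auto
      finally show "\<bar>z $ i \<bullet> (E i j * z $ j)\<bar> \<le> \<epsilon> * (((norm (z $ i))\<^sup>2 + (norm (z $ j))\<^sup>2) / 2)" .
    qed
    finally show "\<bar>s i * (\<Sum>j\<in>UNIV. z $ i \<bullet> (E i j * z $ j))\<bar>
        \<le> (\<Sum>j\<in>UNIV. \<epsilon> * (((norm (z $ i))\<^sup>2 + (norm (z $ j))\<^sup>2) / 2))" .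
  qed
  also have "\<dots> = \<epsilon> * CARD('n) * (norm z)\<^sup>2"
    by (simp add: sum.distrib sum_distrib_left[symmetric] sum_divide_distrib[symmetric] norm_square_vec add_divide_distrib
        mult_ac)
  finally show ?thesis
    by (simp add: row distrib_left sum.distrib mult.assoc)
qed

section \<open>Stability by linearization\<close>

definition complex_vector :: "real^'n \<Rightarrow> complex^'n" where
  "complex_vector x = (\<chi> i. complex_of_real (x $ i))"

lemma complex_vector_nth [simp]: "complex_vector x $ i = complex_of_real (x $ i)"
  by (simp add: complex_vector_def)

lemma complex_matrix_mult_complex_vector:
  "map_matrix complex_of_real M *v complex_vector x = complex_vector (M *v x)"
  by (simp add: vec_eq_iff matrix_vector_mult_def map_matrix_def)

text \<open>
  The weighted sum of squared moduli of the modal coordinates \<open>z = Q x\<close>, polarized to a real bilinear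
  form. The inner product on the complex numbers is \<open>Re (cnj u * v)\<close>.
\<close>
definition modal_form :: "complex^'n::finite^'n \<Rightarrow> ('n \<Rightarrow> real) \<Rightarrow> real^'n \<Rightarrow> real^'n \<Rightarrow> real" where
  "modal_form Q s x y = (\<Sum>i\<in>UNIV. s i * ((Q *v complex_vector x) $ i \<bullet> (Q *v complex_vector y) $ i))"

lemma linear_modal_coordinates: "linear (\<lambda>x. Q *v complex_vector x)"
  by (rule linearI)
    (simp_all add: vec_eq_iff matrix_vector_mult_def algebra_simps sum.distrib sum_distrib_left
      scaleR_conv_of_real[where 'a = complex])

lemma bounded_bilinear_modal_form: "bounded_bilinear (modal_form Q s)"
proof -
  have add: "Q *v complex_vector (x + y) = Q *v complex_vector x + Q *v complex_vector y"
    and scale: "Q *v complex_vector (c *\<^sub>R x) = c *\<^sub>R (Q *v complex_vector x)" for c x y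
    using linear_add[OF linear_modal_coordinates] linear_scale[OF linear_modal_coordinates] by auto
  have "bilinear (modal_form Q s)"
    unfolding bilinear_def modal_form_def
    by (auto intro!: linearI simp: add scale inner_add_left inner_add_right algebra_simps sum.distrib sum_distrib_left)
  then show ?thesis
    by (simp add: bilinear_conv_bounded_bilinear)
qed

lemma modal_form_commute: "modal_form Q s x y = modal_form Q s y x"
  unfolding modal_form_def by (simp add: inner_commute)

lemma modal_form_square: "modal_form Q s x x = (\<Sum>i\<in>UNIV. s i * (norm ((Q *v complex_vector x) $ i))\<^sup>2)"
  unfolding modal_form_def by (simp add: power2_norm_eq_inner)

lemma modal_coordinates_bounded_below:
  assumes "P ** Q = mat 1"
  obtains c where "0 < c" "\<And>x. c * (norm x)\<^sup>2 \<le> (norm (Q *v complex_vector x))\<^sup>2"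
proof -
  have "inj (\<lambda>x. Q *v complex_vector x)"
  proof (rule injI)
    fix x y assume "Q *v complex_vector x = Q *v complex_vector y"
    then have "P *v (Q *v complex_vector x) = P *v (Q *v complex_vector y)"
      by simp
    then have "complex_vector x = complex_vector y"
      using assms by (simp add: matrix_vector_mul_assoc)
    then show "x = y"
      by (simp add: vec_eq_iff)
  qed
  then obtain b where b: "0 < b" "\<And>x. b * norm x \<le> norm (Q *v complex_vector x)"
    using linear_inj_bounded_below_pos[OF linear_modal_coordinates] by blast
  have "b\<^sup>2 * (norm x)\<^sup>2 \<le> (norm (Q *v complex_vector x))\<^sup>2" for x
    using power_mono[OF b(2), of x 2] b(1) by (simp add: power_mult_distrib)
  with b(1) show thesis
    by (intro that[of "b\<^sup>2"]) auto
qed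

text \<open>
  In the modal coordinates the linear map is \<open>Q M P\<close>, which is nearly diagonal.
\<close>
lemma modal_form_derivative_estimate:
  fixes M :: "real^'n::finite^'n"
  assumes PQ: "P ** Q = mat 1"
    and near: "\<And>i j. norm ((Q ** map_matrix complex_of_real M ** P) $ i $ j - (if i = j then d i else 0)) < \<epsilon>"
    and s: "\<And>i. \<bar>s i\<bar> \<le> 1"
  defines "z \<equiv> \<lambda>x. Q *v complex_vector x"
  shows "\<bar>modal_form Q s x (M *v x) - (\<Sum>i\<in>UNIV. s i * Re (d i) * (norm (z x $ i))\<^sup>2)\<bar>
    \<le> \<epsilon> * CARD('n) * (norm (z x))\<^sup>2"
proof -
  let ?A = "map_matrix complex_of_real M"
  have "Q *v complex_vector (M *v x) = (Q ** ?A ** (P ** Q)) *v complex_vector x"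
    by (simp add: PQ complex_matrix_mult_complex_vector matrix_vector_mul_assoc[symmetric])
  also have "\<dots> = (Q ** ?A ** P) *v z x"
    unfolding z_def by (simp only: matrix_vector_mul_assoc matrix_mul_assoc)
  finally have "modal_form Q s x (M *v x) = (\<Sum>i\<in>UNIV. s i * (z x $ i \<bullet> ((Q ** ?A ** P) *v z x) $ i))"
    unfolding modal_form_def z_def by simp
  then show ?thesis
    using nearly_diagonal_estimate[of "Q ** ?A ** P" d \<epsilon> s "z x"] near s by (simp add: less_imp_le)
qed

text \<open>
  With \<open>\<beta>\<close> the distance of the spectrum to the imaginary axis and unit weights, the diagonal part
  contributes at most \<open>- \<beta> (norm z)\<^sup>2\<close>. The error of the near diagonalization is chosen to cost at most half
  of that.
\<close>
theorem exponentially_stable_if_eigenvalues_negative: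
  fixes F :: "real^'n::finite \<Rightarrow> real^'n"
  assumes F: "(F has_derivative (\<lambda>x. M *v x)) (at 0)" "F 0 = 0"
    and lip: "K-lipschitz_on (cball 0 r) F" "0 < r"
    and neg: "\<And>\<kappa>. \<kappa> \<in> eigenvalues M \<Longrightarrow> Re \<kappa> < 0"
  shows "locally_exponentially_stable F 0"
proof -
  define \<beta> where "\<beta> = Min ((\<lambda>\<kappa>. - Re \<kappa>) ` eigenvalues M)"
  have \<beta>: "0 < \<beta>"
    unfolding \<beta>_def using finite_eigenvalues eigenvalues_nonempty neg by (subst Min_gr_iff) auto
  have Re_le: "Re \<kappa> \<le> - \<beta>" if "\<kappa> \<in> eigenvalues M" for \<kappa>
    using Min_le[of "(\<lambda>\<kappa>. - Re \<kappa>) ` eigenvalues M" "- Re \<kappa>"] that finite_eigenvalues unfolding \<beta>_def by fastforce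
  define \<epsilon> where "\<epsilon> = \<beta> / (2 * CARD('n))"
  have \<epsilon>: "0 < \<epsilon>" "\<epsilon> * CARD('n) = \<beta> / 2"
    using \<beta> by (simp_all add: \<epsilon>_def)
  obtain P Q :: "complex^'n^'n" and d where PQ: "P ** Q = mat 1" and d: "\<And>i. d i \<in> eigenvalues M"
    and near: "\<And>i j. norm ((Q ** map_matrix complex_of_real M ** P) $ i $ j - (if i = j then d i else 0)) < \<epsilon>"
    using nearly_diagonal_form[OF \<epsilon>(1)] by metis
  obtain c where c: "0 < c" "\<And>x. c * (norm x)\<^sup>2 \<le> (norm (Q *v complex_vector x))\<^sup>2"
    using modal_coordinates_bounded_below[OF PQ] by blast
  let ?B = "modal_form Q (\<lambda>_. 1)"
  show ?thesis
  proof (rule exponentially_stable_if_negative_form[OF F lip bounded_bilinear_modal_form modal_form_commute c(1)])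
    show "c * (norm x)\<^sup>2 \<le> ?B x x" for x
      using c(2)[of x] by (simp add: modal_form_square norm_square_vec)
    show "0 < \<beta> / 2 * c"
      using \<beta> c(1) by simp
    fix x
    let ?z = "Q *v complex_vector x"
    have "(\<Sum>i\<in>UNIV. 1 * Re (d i) * (norm (?z $ i))\<^sup>2) \<le> (\<Sum>i\<in>UNIV. - \<beta> * (norm (?z $ i))\<^sup>2)"
      using Re_le d by (intro sum_mono mult_right_mono) auto
    also have "\<dots> = - \<beta> * (norm ?z)\<^sup>2"
      by (simp only: norm_square_vec sum_distrib_left)
    finally have "?B x (M *v x) \<le> - \<beta> * (norm ?z)\<^sup>2 + \<beta> / 2 * (norm ?z)\<^sup>2"
      using modal_form_derivative_estimate[OF PQ near, of "\<lambda>_. 1" x] \<epsilon>(2) unfolding abs_le_iff by simp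
    also have "\<dots> = - (\<beta> / 2) * (norm ?z)\<^sup>2"
      by (simp add: field_simps)
    also have "\<dots> \<le> - (\<beta> / 2) * (c * (norm x)\<^sup>2)"
      using \<beta> c(2)[of x] by simp
    finally show "?B x (M *v x) \<le> - (\<beta> / 2 * c) * (norm x)\<^sup>2"
      by simp
  qed
qed

text \<open>
  An expanding form cannot be negative semidefinite when \<open>M\<close> has an eigenvalue with real part above
  \<open>\<sigma>\<close>. For an eigenvector \<open>a + \<i> b\<close> of \<open>\<kappa>\<close>, symmetry of \<open>B\<close> cancels the contributions of \<open>Im \<kappa>\<close>, so that
  \<open>B a (M a) + B b (M b) = Re \<kappa> (B a a + B b b)\<close>; the expansion inequality then makes
  \<open>B a a + B b b\<close> positive. This detour through the eigenvector is needed because the modal coordinates of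
  real vectors need not include the coordinate axes on which the form is evidently positive.
\<close>
lemma positive_form_if_expanding:
  fixes M :: "real^'n::finite^'n" and B :: "real^'n \<Rightarrow> real^'n \<Rightarrow> real"
  assumes bil: "bounded_bilinear B" and sym: "\<And>x y. B x y = B y x"
    and \<eta>: "0 < \<eta>"
    and expanding: "\<And>x. \<sigma> * B x x + \<eta> * (norm x)\<^sup>2 \<le> B x (M *v x)"
    and \<kappa>: "\<kappa> \<in> eigenvalues M" "\<sigma> < Re \<kappa>"
  shows "\<exists>v. 0 < B v v"
proof -
  interpret bounded_bilinear B by fact
  obtain w where w: "w \<noteq> 0" "map_matrix complex_of_real M *v w = \<kappa> *s w"
    using \<kappa>(1) by (auto simp: eigenvalues_def)
  define a b :: "real^'n" where "a = (\<chi> i. Re (w $ i))" and "b = (\<chi> i. Im (w $ i))"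
  have eq: "(\<Sum>j\<in>UNIV. complex_of_real (M $ i $ j) * w $ j) = \<kappa> * w $ i" for i
    using w(2) by (simp add: vec_eq_iff matrix_vector_mult_def map_matrix_def)
  have Ma: "M *v a = Re \<kappa> *\<^sub>R a - Im \<kappa> *\<^sub>R b"
    using arg_cong[OF eq, of Re] by (simp add: vec_eq_iff matrix_vector_mult_def a_def b_def)
  have Mb: "M *v b = Im \<kappa> *\<^sub>R a + Re \<kappa> *\<^sub>R b"
    using arg_cong[OF eq, of Im] by (simp add: vec_eq_iff matrix_vector_mult_def a_def b_def add.commute)
  have "B a (M *v a) + B b (M *v b) = Re \<kappa> * (B a a + B b b)"
    by (simp add: Ma Mb diff_right add_right scaleR_right sym[of b a] algebra_simps)
  then have "\<eta> * ((norm a)\<^sup>2 + (norm b)\<^sup>2) \<le> (Re \<kappa> - \<sigma>) * (B a a + B b b)"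
    using expanding[of a] expanding[of b] by (simp add: algebra_simps)
  moreover have "a \<noteq> 0 \<or> b \<noteq> 0"
    using w(1) by (auto simp: a_def b_def vec_eq_iff complex_eq_iff)
  then have "0 < \<eta> * ((norm a)\<^sup>2 + (norm b)\<^sup>2)"
    using \<eta> by (auto intro!: mult_pos_pos simp: add_pos_nonneg add_nonneg_pos)
  ultimately have "0 < (Re \<kappa> - \<sigma>) * (B a a + B b b)"
    by linarith
  then have "0 < B a a + B b b"
    using \<kappa>(2) by (simp add: zero_less_mult_iff)
  then show ?thesis
    by (metis add_nonpos_nonpos not_less)
qed

text \<open>
  Let \<open>2 \<sigma>\<close> be the least positive real part of an eigenvalue. With weight \<open>1\<close> on the eigenvalues of
  positive real part and \<open>- 1\<close> on the others, \<open>s\<^sub>i Re d\<^sub>i \<ge> \<sigma> s\<^sub>i + \<sigma>\<close> in either case: the left side is at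
  least \<open>2 \<sigma>\<close> in the first and nonnegative in the second. So the form expands at rate \<open>\<sigma>\<close> with
  a margin \<open>\<sigma> (norm z)\<^sup>2\<close>, half of which absorbs the error of the near diagonalization.
\<close>
theorem unstable_if_eigenvalue_positive:
  fixes F :: "real^'n::finite \<Rightarrow> real^'n"
  assumes F: "(F has_derivative (\<lambda>x. M *v x)) (at 0)" "F 0 = 0"
    and \<kappa>: "\<kappa> \<in> eigenvalues M" "0 < Re \<kappa>"
  shows "unstable F 0"
proof -
  define \<sigma> where "\<sigma> = Min (Re ` eigenvalues M \<inter> {0<..}) / 2"
  have fin: "finite (Re ` eigenvalues M \<inter> {0<..})" and mem: "Re \<kappa> \<in> Re ` eigenvalues M \<inter> {0<..}"
    using finite_eigenvalues \<kappa> by auto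
  have \<sigma>: "0 < \<sigma>"
    using Min_in[OF fin] mem by (auto simp: \<sigma>_def)
  have gap: "2 * \<sigma> \<le> Re \<nu>" if "\<nu> \<in> eigenvalues M" "0 < Re \<nu>" for \<nu>
    using Min_le[OF fin] that by (auto simp: \<sigma>_def)
  define \<epsilon> where "\<epsilon> = \<sigma> / (2 * CARD('n))"
  have \<epsilon>: "0 < \<epsilon>" "\<epsilon> * CARD('n) = \<sigma> / 2"
    using \<sigma> by (simp_all add: \<epsilon>_def)
  obtain P Q :: "complex^'n^'n" and d where PQ: "P ** Q = mat 1" and d: "\<And>i. d i \<in> eigenvalues M"
    and near: "\<And>i j. norm ((Q ** map_matrix complex_of_real M ** P) $ i $ j - (if i = j then d i else 0)) < \<epsilon>"
    using nearly_diagonal_form[OF \<epsilon>(1)] by metis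
  obtain c where c: "0 < c" "\<And>x. c * (norm x)\<^sup>2 \<le> (norm (Q *v complex_vector x))\<^sup>2"
    using modal_coordinates_bounded_below[OF PQ] by blast
  define s :: "'n \<Rightarrow> real" where "s i = (if 0 < Re (d i) then 1 else - 1)" for i
  let ?B = "modal_form Q s"
  have \<eta>: "0 < \<sigma> / 2 * c"
    using \<sigma> c(1) by simp
  have expanding: "\<sigma> * ?B x x + \<sigma> / 2 * c * (norm x)\<^sup>2 \<le> ?B x (M *v x)" for x
  proof -
    let ?z = "Q *v complex_vector x"
    have "\<sigma> * s i + \<sigma> \<le> s i * Re (d i)" for i
      using gap[OF d, of i] \<sigma> by (auto simp: s_def)
    then have "(\<Sum>i\<in>UNIV. (\<sigma> * s i + \<sigma>) * (norm (?z $ i))\<^sup>2) \<le> (\<Sum>i\<in>UNIV. s i * Re (d i) * (norm (?z $ i))\<^sup>2)"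
      by (intro sum_mono mult_right_mono) auto
    moreover have "(\<Sum>i\<in>UNIV. (\<sigma> * s i + \<sigma>) * (norm (?z $ i))\<^sup>2) = \<sigma> * ?B x x + \<sigma> * (norm ?z)\<^sup>2"
      by (simp add: modal_form_square norm_square_vec distrib_right sum.distrib sum_distrib_left mult.assoc)
    moreover have "\<bar>?B x (M *v x) - (\<Sum>i\<in>UNIV. s i * Re (d i) * (norm (?z $ i))\<^sup>2)\<bar> \<le> \<sigma> / 2 * (norm ?z)\<^sup>2"
      using modal_form_derivative_estimate[OF PQ near, of s x] unfolding \<epsilon>(2) by (simp add: s_def)
    ultimately have "\<sigma> * ?B x x + \<sigma> / 2 * (norm ?z)\<^sup>2 \<le> ?B x (M *v x)"
      unfolding abs_le_iff by (simp add: field_simps)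
    moreover have "\<sigma> / 2 * (c * (norm x)\<^sup>2) \<le> \<sigma> / 2 * (norm ?z)\<^sup>2"
      using \<sigma> c(2)[of x] by (intro mult_left_mono) auto
    ultimately show ?thesis
      by (simp add: mult.assoc)
  qed
  obtain v where "0 < ?B v v"
    using positive_form_if_expanding[OF bounded_bilinear_modal_form modal_form_commute \<eta> expanding \<kappa>(1)]
      gap[OF \<kappa>] \<sigma> by auto
  then show ?thesis
    by (rule unstable_if_expanding_form[OF F bounded_bilinear_modal_form modal_form_commute \<sigma> \<eta> expanding])
qed

section \<open>The spectrum of the coupling matrix\<close>

text \<open>
  Gershgorin: in the row where an eigenvector is largest, the eigenvalue is within the off-diagonal row
  sum of the diagonal entry, hence in a disc that touches the imaginary axis at most from the right.
\<close>
lemma re_eigenvalue_nonneg_if_diagonally_dominant: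
  fixes M :: "real^'n::finite^'n"
  assumes dominant: "\<And>i. (\<Sum>j\<in>UNIV - {i}. \<bar>M $ i $ j\<bar>) \<le> M $ i $ i"
    and \<kappa>: "\<kappa> \<in> eigenvalues M"
  shows "0 \<le> Re \<kappa>"
proof -
  obtain v where v: "v \<noteq> 0" "map_matrix complex_of_real M *v v = \<kappa> *s v"
    using \<kappa> by (auto simp: eigenvalues_def)
  have "Max (range (\<lambda>i. norm (v $ i))) \<in> range (\<lambda>i. norm (v $ i))"
    by (intro Max_in) auto
  then obtain i where i: "Max (range (\<lambda>i. norm (v $ i))) = norm (v $ i)"
    by (rule imageE)
  have max: "norm (v $ j) \<le> norm (v $ i)" for j
    unfolding i[symmetric] by (intro Max_ge) auto
  have pos: "0 < norm (v $ i)"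
  proof (rule ccontr)
    assume "\<not> 0 < norm (v $ i)"
    then have "norm (v $ j) \<le> 0" for j
      using max[of j] by simp
    with v(1) show False
      by (simp add: vec_eq_iff)
  qed
  have "(\<Sum>j\<in>UNIV. complex_of_real (M $ i $ j) * v $ j) = \<kappa> * v $ i"
    using arg_cong[OF v(2), of "\<lambda>u. u $ i"] by (simp add: matrix_vector_mult_def map_matrix_def)
  then have "(\<kappa> - complex_of_real (M $ i $ i)) * v $ i
      = (\<Sum>j\<in>UNIV - {i}. complex_of_real (M $ i $ j) * v $ j)"
    by (simp add: sum.remove[of UNIV i] algebra_simps)
  then have "norm (\<kappa> - complex_of_real (M $ i $ i)) * norm (v $ i)
      = norm (\<Sum>j\<in>UNIV - {i}. complex_of_real (M $ i $ j) * v $ j)"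
    by (metis norm_mult)
  also have "\<dots> \<le> (\<Sum>j\<in>UNIV - {i}. \<bar>M $ i $ j\<bar> * norm (v $ i))"
    by (intro sum_norm_le) (simp add: norm_mult mult_left_mono max)
  also have "\<dots> \<le> M $ i $ i * norm (v $ i)"
    unfolding sum_distrib_right[symmetric] using dominant by (intro mult_right_mono) auto
  finally have "norm (\<kappa> - complex_of_real (M $ i $ i)) \<le> M $ i $ i"
    using pos by simp
  then have "\<bar>Re (\<kappa> - complex_of_real (M $ i $ i))\<bar> \<le> M $ i $ i"
    using abs_Re_le_cmod order_trans by blast
  then show ?thesis
    by simp
qed

text \<open>
  The trace is the sum of the diagonal entries of the Schur form, which are eigenvalues.
\<close>
lemma eigenvalue_positive_if_trace_positive:
  fixes M :: "real^'n::finite^'n"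
  assumes "0 < trace M"
  obtains \<kappa> where "\<kappa> \<in> eigenvalues M" "0 < Re \<kappa>"
proof -
  let ?A = "map_matrix complex_of_real M"
  obtain P Q T :: "complex^'n^'n" where PQ: "Q ** P = mat 1" and A: "?A = P ** T ** Q"
    and eig: "range (\<lambda>i. T $ i $ i) = {\<nu>. \<exists>v. v \<noteq> 0 \<and> ?A *v v = \<nu> *s v}"
    by (rule complex_schur_form[of ?A]) (rule that)
  have "trace ?A = trace (Q ** (P ** T))"
    unfolding A by (rule trace_mul_sym)
  also have "\<dots> = trace T"
    by (simp add: matrix_mul_assoc PQ)
  finally have "trace M = (\<Sum>i\<in>UNIV. Re (T $ i $ i))"
    by (simp add: trace_def complex_eq_iff map_matrix_def)
  then obtain i where "0 < Re (T $ i $ i)"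
    using assms sum_nonpos[of UNIV "\<lambda>i. Re (T $ i $ i)"] by (metis not_less)
  moreover have "T $ i $ i \<in> eigenvalues M"
    using eig unfolding eigenvalues_def by blast
  ultimately show thesis
    using that by blast
qed

text \<open>
  The two choices of \<open>L\<close> differ only in the sign of the off-diagonal entries, to which neither
  Gershgorin's bound nor the trace is sensitive. A connected graph
  with two distinct vertices has an arc, which makes the trace positive.
\<close>
lemma coupling_matrix_spectrum:
  fixes G :: "('n::finite, 'e) pre_digraph"
  assumes G: "digraph G" "verts G = UNIV" "CARD('n) \<ge> 2" "Digraph_Component.connected G"
    and L: "L = laplacian_minus G \<or> L = laplacian_plus G"
  shows "\<And>\<kappa>. \<kappa> \<in> eigenvalues L \<Longrightarrow> 0 \<le> Re \<kappa>" and "\<exists>\<kappa>\<in>eigenvalues L. 0 < Re \<kappa>"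
proof -
  interpret digraph G by fact
  let ?A = "adjacency_matrix G"
  have A_nonneg: "0 \<le> ?A $ i $ j" for i j
    by (simp add: adjacency_matrix_def)
  have A_diag: "?A $ i $ i = 0" for i
    using no_loops by (auto simp: adjacency_matrix_def arcs_ends_conv)
  have diag: "L $ i $ i = (\<Sum>j\<in>UNIV. ?A $ i $ j)" for i
    using L by (auto simp: laplacian_minus_def laplacian_plus_def in_degree_matrix_def diag_matrix_def A_diag
        matrix_vector_mult_def)
  have off_diag: "\<bar>L $ i $ j\<bar> = ?A $ i $ j" if "i \<noteq> j" for i j
    using L that A_nonneg[of i j]
    by (auto simp: laplacian_minus_def laplacian_plus_def in_degree_matrix_def diag_matrix_def)
  have "(\<Sum>j\<in>UNIV - {i}. \<bar>L $ i $ j\<bar>) \<le> L $ i $ i" for i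
  proof -
    have "(\<Sum>j\<in>UNIV. ?A $ i $ j) = ?A $ i $ i + (\<Sum>j\<in>UNIV - {i}. ?A $ i $ j)"
      by (rule sum.remove) auto
    also have "(\<Sum>j\<in>UNIV - {i}. ?A $ i $ j) = (\<Sum>j\<in>UNIV - {i}. \<bar>L $ i $ j\<bar>)"
      by (intro sum.cong) (auto simp: off_diag)
    finally show ?thesis
      by (simp add: diag A_diag)
  qed
  then show "0 \<le> Re \<kappa>" if "\<kappa> \<in> eigenvalues L" for \<kappa>
    using that by (rule re_eigenvalue_nonneg_if_diagonally_dominant)
  obtain u w :: 'n where uw: "u \<noteq> w"
    using card_le_Suc0_iff_eq[of "UNIV :: 'n set"] G(3) by auto
  have "arcs G \<noteq> {}"
  proof
    assume "arcs G = {}"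
    then have "arcs_ends (with_proj (mk_symmetric G)) = {}"
      by (simp add: parcs_mk_symmetric arcs_ends_conv)
    moreover have "u \<rightarrow>\<^sup>*\<^bsub>with_proj (mk_symmetric G)\<^esub> w"
      using G(2,4) by (simp add: connected_def strongly_connected_def)
    then have "(u, w) \<in> (arcs_ends (with_proj (mk_symmetric G)))\<^sup>*"
      by (rule reachable_rtranclI)
    ultimately show False
      using uw by simp
  qed
  then obtain e where "e \<in> arcs G"
    by blast
  then have "0 < ?A $ head G e $ tail G e"
    by (auto simp: adjacency_matrix_def arcs_ends_conv)
  then have "0 < (\<Sum>j\<in>UNIV. ?A $ head G e $ j)"
    using A_nonneg by (intro sum_pos2[of UNIV "tail G e"]) auto
  then have "0 < (\<Sum>i\<in>UNIV. \<Sum>j\<in>UNIV. ?A $ i $ j)"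
    using A_nonneg by (intro sum_pos2[of UNIV "head G e" "\<lambda>i. \<Sum>j\<in>UNIV. ?A $ i $ j"]) (auto intro: sum_nonneg)
  then have "0 < trace L"
    by (simp add: trace_def diag)
  then show "\<exists>\<kappa>\<in>eigenvalues L. 0 < Re \<kappa>"
    using eigenvalue_positive_if_trace_positive by blast
qed

section \<open>Linearization of the network\<close>

definition network_jacobian :: "real^'d^'d \<Rightarrow> real \<Rightarrow> real^'n^'n \<Rightarrow> real^('n::finite \<times> 'd::finite)^('n \<times> 'd)" where
  "network_jacobian J \<alpha> L = kronecker_product (mat 1) J + \<alpha> *\<^sub>R kronecker_product L (mat 1)"

text \<open>
  For the state written as an array \<open>w\<close> of nodes by coordinates, the node Jacobian acts along the rows and the
  coupling along the columns.
\<close>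
lemma network_jacobian_complex_mult_nth:
  "(map_matrix complex_of_real (network_jacobian J \<alpha> L) *v w) $ (i, k)
    = (\<Sum>l\<in>UNIV. J $ k $ l * w $ (i, l)) + \<alpha> * (\<Sum>j\<in>UNIV. L $ i $ j * w $ (j, k))"
proof -
  have "(map_matrix complex_of_real (network_jacobian J \<alpha> L) *v w) $ (i, k)
      = (\<Sum>c\<in>UNIV \<times> UNIV. ((if i = fst c then J $ k $ snd c else 0) + \<alpha> * (if k = snd c then L $ i $ fst c else 0)) * w $ c)"
    unfolding matrix_vector_mult_def network_jacobian_def kronecker_product_def map_matrix_def
    by (auto simp: mat_def intro!: sum.cong)
  also have "\<dots> = (\<Sum>(j, l)\<in>UNIV \<times> UNIV. (if i = j then J $ k $ l * w $ (j, l) else 0)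
      + (if k = l then \<alpha> * (L $ i $ j * w $ (j, l)) else 0))"
    by (intro sum.cong) (auto simp: algebra_simps)
  also have "\<dots> = (\<Sum>j\<in>UNIV. \<Sum>l\<in>UNIV. (if i = j then J $ k $ l * w $ (j, l) else 0))
      + (\<Sum>j\<in>UNIV. \<Sum>l\<in>UNIV. (if k = l then \<alpha> * (L $ i $ j * w $ (j, l)) else 0))"
    by (simp only: sum.cartesian_product[symmetric] sum.distrib)
  also have "(\<Sum>j\<in>UNIV. \<Sum>l\<in>UNIV. (if i = j then J $ k $ l * w $ (j, l) else 0))
      = (\<Sum>l\<in>UNIV. J $ k $ l * w $ (i, l))"
    by (subst sum.swap) simp
  finally show ?thesis
    by (simp add: sum_distrib_left)
qed

text \<open>
  Products \<open>u\<^sub>i v\<^sub>k\<close> of eigenvectors give one inclusion. For the other, let \<open>w\<close> be an eigenvector for \<open>\<mu>\<close>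
  and let \<open>L = P T Q\<close> be a Schur form. Replacing every column of the array \<open>w\<close> by its product with \<open>Q\<close>
  turns \<open>L\<close> into the triangular matrix \<open>T\<close>. In the last nonzero row of the new array only the diagonal entry
  \<open>T\<^sub>i\<^sub>i\<close> is felt, so that row is an eigenvector of \<open>J\<close> for \<open>\<mu> - \<alpha> T\<^sub>i\<^sub>i\<close>.
\<close>
lemma eigenvalues_network_jacobian:
  fixes J :: "real^'d::finite^'d" and L :: "real^'n::finite^'n"
  shows "eigenvalues (network_jacobian J \<alpha> L)
    = {\<nu> + of_real \<alpha> * \<kappa> | \<nu> \<kappa>. \<nu> \<in> eigenvalues J \<and> \<kappa> \<in> eigenvalues L}"
proof (intro subset_antisym subsetI)
  fix \<mu> assume "\<mu> \<in> {\<nu> + of_real \<alpha> * \<kappa> | \<nu> \<kappa>. \<nu> \<in> eigenvalues J \<and> \<kappa> \<in> eigenvalues L}"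
  then obtain \<nu> \<kappa> v u where \<mu>: "\<mu> = \<nu> + of_real \<alpha> * \<kappa>"
    and v: "v \<noteq> 0" "map_matrix complex_of_real J *v v = \<nu> *s v"
    and u: "u \<noteq> 0" "map_matrix complex_of_real L *v u = \<kappa> *s u"
    by (auto simp: eigenvalues_def)
  define w where "w = (\<chi> r. u $ fst r * v $ snd r)"
  have Jv: "(\<Sum>l\<in>UNIV. complex_of_real (J $ k $ l) * v $ l) = \<nu> * v $ k" for k
    using arg_cong[OF v(2), of "\<lambda>x. x $ k"] by (simp add: matrix_vector_mult_def map_matrix_def)
  have Lu: "(\<Sum>j\<in>UNIV. complex_of_real (L $ i $ j) * u $ j) = \<kappa> * u $ i" for i
    using arg_cong[OF u(2), of "\<lambda>x. x $ i"] by (simp add: matrix_vector_mult_def map_matrix_def)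
  have "(map_matrix complex_of_real (network_jacobian J \<alpha> L) *v w) $ (i, k) = (\<mu> *s w) $ (i, k)" for i k
  proof -
    have "(map_matrix complex_of_real (network_jacobian J \<alpha> L) *v w) $ (i, k)
        = u $ i * (\<Sum>l\<in>UNIV. J $ k $ l * v $ l) + \<alpha> * ((\<Sum>j\<in>UNIV. L $ i $ j * u $ j) * v $ k)"
      unfolding network_jacobian_complex_mult_nth w_def
      by (simp add: sum_distrib_left sum_distrib_right mult_ac)
    then show ?thesis
      unfolding Jv Lu \<mu> by (simp add: w_def algebra_simps)
  qed
  moreover have "w \<noteq> 0"
    using v(1) u(1) by (auto simp: w_def vec_eq_iff)
  ultimately show "\<mu> \<in> eigenvalues (network_jacobian J \<alpha> L)"
    unfolding eigenvalues_def by (auto simp: vec_eq_iff[of "_ *v _"] intro!: exI[of _ w])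
next
  fix \<mu> assume "\<mu> \<in> eigenvalues (network_jacobian J \<alpha> L)"
  then obtain w where w: "w \<noteq> 0" "map_matrix complex_of_real (network_jacobian J \<alpha> L) *v w = \<mu> *s w"
    by (auto simp: eigenvalues_def)
  let ?L = "map_matrix complex_of_real L"
  obtain P Q T :: "complex^'n^'n" and idx :: "'n \<Rightarrow> nat"
    where PQ: "P ** Q = mat 1" "Q ** P = mat 1" and LT: "?L = P ** T ** Q"
      and idx: "inj idx" and tri: "\<And>i j. idx j < idx i \<Longrightarrow> T $ i $ j = 0"
      and eig: "range (\<lambda>i. T $ i $ i) = {\<nu>. \<exists>v. v \<noteq> 0 \<and> ?L *v v = \<nu> *s v}"
    by (rule complex_schur_form[of ?L]) (rule that)
  define col where "col k = (\<chi> j. w $ (j, k))" for k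
  define y where "y k = Q *v col k" for k
  have block: "\<mu> * col k $ i = (\<Sum>l\<in>UNIV. J $ k $ l * col l $ i) + \<alpha> * (?L *v col k) $ i" for k i
    using arg_cong[OF w(2), of "\<lambda>x. x $ (i, k)"] unfolding network_jacobian_complex_mult_nth
    by (simp add: col_def matrix_vector_mult_def map_matrix_def)
  have "T *v y k = Q *v (?L *v col k)" for k
    unfolding y_def LT matrix_vector_mul_assoc by (simp add: matrix_mul_assoc PQ)
  then have Ty: "(T *v y k) $ i = (\<Sum>j\<in>UNIV. Q $ i $ j * (?L *v col k) $ j)" for i k
    by (simp add: matrix_vector_mult_def)
  have rows: "\<mu> * y k $ i = (\<Sum>l\<in>UNIV. J $ k $ l * y l $ i) + \<alpha> * (T *v y k) $ i" for k i
  proof -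
    have "\<mu> * y k $ i = (\<Sum>j\<in>UNIV. Q $ i $ j * (\<mu> * col k $ j))"
      by (simp add: y_def matrix_vector_mult_def sum_distrib_left mult_ac)
    also have "\<dots> = (\<Sum>j\<in>UNIV. \<Sum>l\<in>UNIV. J $ k $ l * (Q $ i $ j * col l $ j)) + \<alpha> * (T *v y k) $ i"
      unfolding block Ty by (simp add: distrib_left sum.distrib sum_distrib_left mult_ac)
    also have "(\<Sum>j\<in>UNIV. \<Sum>l\<in>UNIV. J $ k $ l * (Q $ i $ j * col l $ j)) = (\<Sum>l\<in>UNIV. J $ k $ l * y l $ i)"
      by (subst sum.swap) (simp add: y_def matrix_vector_mult_def sum_distrib_left)
    finally show ?thesis .
  qed
  define S where "S = {i. \<exists>k. y k $ i \<noteq> 0}"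
  have "S \<noteq> {}"
  proof
    assume "S = {}"
    then have "y k = 0" for k
      by (simp add: S_def vec_eq_iff)
    then have "P *v y k = 0" for k
      by simp
    then have "col k = 0" for k
      unfolding y_def by (simp add: matrix_vector_mul_assoc PQ)
    then have "w = 0"
      by (simp add: col_def vec_eq_iff)
    with w(1) show False by simp
  qed
  then have "Max (idx ` S) \<in> idx ` S"
    by (intro Max_in) auto
  then obtain i where i: "i \<in> S" "idx i = Max (idx ` S)"
    by auto
  have last: "y k $ j = 0" if "idx i < idx j" for k j
  proof (rule ccontr)
    assume "y k $ j \<noteq> 0"
    then have "idx j \<le> idx i"
      unfolding i(2) by (intro Max_ge) (auto simp: S_def)
    with that show False by simp
  qed
  have Tyi: "(T *v y k) $ i = T $ i $ i * y k $ i" for k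
  proof -
    have "T $ i $ j * y k $ j = 0" if "j \<noteq> i" for j
      using that injD[OF idx, of i j] tri[of j i] last[of j k] by (cases "idx i" "idx j" rule: linorder_cases) auto
    then have "(\<Sum>j\<in>UNIV - {i}. T $ i $ j * y k $ j) = 0"
      by (intro sum.neutral) auto
    then show ?thesis
      unfolding matrix_vector_mult_def by (simp add: sum.remove[of UNIV i])
  qed
  define v where "v = (\<chi> k. y k $ i)"
  define \<nu> where "\<nu> = \<mu> - \<alpha> * T $ i $ i"
  have "v \<noteq> 0"
    using i(1) by (auto simp: v_def S_def vec_eq_iff)
  moreover have "map_matrix complex_of_real J *v v = \<nu> *s v"
    using rows[of _ i] unfolding Tyi
    by (simp add: vec_eq_iff matrix_vector_mult_def map_matrix_def v_def \<nu>_def algebra_simps)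
  ultimately have "\<nu> \<in> eigenvalues J"
    unfolding eigenvalues_def by blast
  moreover have "T $ i $ i \<in> eigenvalues L"
    using eig unfolding eigenvalues_def by blast
  moreover have "\<mu> = \<nu> + \<alpha> * T $ i $ i"
    by (simp add: \<nu>_def)
  ultimately show "\<mu> \<in> {\<nu> + of_real \<alpha> * \<kappa> | \<nu> \<kappa>. \<nu> \<in> eigenvalues J \<and> \<kappa> \<in> eigenvalues L}"
    by blast
qed

lemma C1_field_lipschitz:
  fixes f :: "real^'d::finite \<Rightarrow> real^'d"
  assumes "C1_field f"
  shows "\<exists>K. K-lipschitz_on (cball 0 r) f"
proof -
  have deriv: "(f has_derivative (*v) (jacobian f (at x))) (at x)" for x
    using assms unfolding C1_field_def differentiable_on_def by (simp add: jacobian_works[symmetric])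
  have "compact ((\<lambda>x. jacobian f (at x)) ` cball 0 r)"
    using assms unfolding C1_field_def by (intro compact_continuous_image compact_cball) (auto intro: continuous_on_subset)
  then obtain b where b: "0 < b" "\<And>x. x \<in> cball 0 r \<Longrightarrow> norm (jacobian f (at x)) \<le> b"
    by (auto dest!: compact_imp_bounded simp: bounded_pos)
  let ?C = "real CARD('d) * real CARD('d) * b"
  have "onorm ((*v) (jacobian f (at x))) \<le> ?C" if "x \<in> cball 0 r" for x
  proof (rule onorm_le_matrix_component)
    fix i j
    have "\<bar>jacobian f (at x) $ i $ j\<bar> \<le> norm (jacobian f (at x) $ i)"
      by (rule component_le_norm_cart)
    also have "\<dots> \<le> norm (jacobian f (at x))"
      by (rule Finite_Cartesian_Product.norm_nth_le)
    finally show "\<bar>jacobian f (at x) $ i $ j\<bar> \<le> b"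
      using b(2)[OF that] by linarith
  qed
  then have "?C-lipschitz_on (cball 0 r) f"
    using deriv b(1) by (intro bounded_derivative_imp_lipschitz) (auto intro: has_derivative_at_withinI)
  then show ?thesis ..
qed

lemma linear_node_state: "linear (\<lambda>x. node_state x i)"
  by (rule linearI) (simp_all add: node_state_def vec_eq_iff)

text \<open>
  Unit balls are thus mapped into unit balls, so that a Lipschitz constant of \<open>f\<close> on the unit ball of the node space
  yields one for the network field on the unit ball of its state space.
\<close>
lemma norm_node_state_le: "norm (node_state x i) \<le> norm x"
proof (rule power2_le_imp_le)
  have "(norm (node_state x i))\<^sup>2 = (\<Sum>k\<in>UNIV. (norm (x $ (i, k)))\<^sup>2)"
    by (simp add: norm_square_vec node_state_def)
  also have "\<dots> = (\<Sum>r\<in>range (Pair i). (norm (x $ r))\<^sup>2)"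
    by (subst sum.reindex) (auto simp: inj_on_def)
  also have "\<dots> \<le> (norm x)\<^sup>2"
    unfolding norm_square_vec by (intro sum_mono2) auto
  finally show "(norm (node_state x i))\<^sup>2 \<le> (norm x)\<^sup>2" .
qed simp

lemma network_field_lipschitz:
  fixes f :: "real^'d::finite \<Rightarrow> real^'d" and L :: "real^'n::finite^'n"
  assumes "C1_field f"
  obtains K where "K-lipschitz_on (cball 0 1) (network_field f \<alpha> L)"
proof -
  obtain K where K: "K-lipschitz_on (cball 0 1) f"
    using C1_field_lipschitz[OF assms] by blast
  let ?U = "uncoupled_field f :: real^('n \<times> 'd) \<Rightarrow> _"
  have U: "(CARD('n \<times> 'd) * K)-lipschitz_on (cball 0 1) ?U"
  proof (rule lipschitz_onI)
    show "0 \<le> CARD('n \<times> 'd) * K"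
      using lipschitz_on_nonneg[OF K] by simp
    fix x y :: "real^('n \<times> 'd)" assume xy: "x \<in> cball 0 1" "y \<in> cball 0 1"
    have "dist (?U x) (?U y) \<le> (\<Sum>r\<in>UNIV. \<bar>(?U x - ?U y) $ r\<bar>)"
      unfolding dist_norm by (rule norm_le_l1_cart)
    also have "\<dots> \<le> (\<Sum>r\<in>(UNIV :: ('n \<times> 'd) set). K * dist x y)"
    proof (rule sum_mono)
      fix r :: "'n \<times> 'd"
      have "\<bar>(?U x - ?U y) $ r\<bar> \<le> norm (f (node_state x (fst r)) - f (node_state y (fst r)))"
        using component_le_norm_cart[of "f (node_state x (fst r)) - f (node_state y (fst r))" "snd r"]
        by (simp add: uncoupled_field_def)
      also have "\<dots> \<le> K * norm (node_state x (fst r) - node_state y (fst r))"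
        using lipschitz_onD[OF K, of "node_state x (fst r)" "node_state y (fst r)"] xy
          norm_node_state_le[of x "fst r"] norm_node_state_le[of y "fst r"] by (simp add: dist_norm)
      also have "\<dots> \<le> K * norm (x - y)"
        unfolding linear_diff[OF linear_node_state, symmetric]
        by (intro mult_left_mono norm_node_state_le lipschitz_on_nonneg[OF K])
      finally show "\<bar>(?U x - ?U y) $ r\<bar> \<le> K * dist x y"
        by (simp add: dist_norm)
    qed
    finally show "dist (?U x) (?U y) \<le> CARD('n \<times> 'd) * K * dist x y"
      by simp
  qed
  obtain B where
    B: "B-lipschitz_on (cball 0 1) (\<lambda>x. kronecker_product L (mat 1 :: real^'d^'d) *v x)"
    by (rule bounded_linear.lipschitz_boundE[OF matrix_vector_mul_bounded_linear])
  show thesis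
    by (rule that[unfolded network_field_def[abs_def], OF lipschitz_on_add[OF U lipschitz_on_cmult[OF B]]])
qed

lemma kronecker_identity_mult: "kronecker_product (mat 1) J *v x = uncoupled_field ((*v) J) x"
  for J :: "real^'d::finite^'d" and x :: "real^('n::finite \<times> 'd)"
proof -
  have "(kronecker_product (mat 1) J *v x) $ (i, k) = uncoupled_field ((*v) J) x $ (i, k)" for i k
  proof -
    have "(kronecker_product (mat 1) J *v x) $ (i, k)
        = (\<Sum>(j, l)\<in>UNIV \<times> UNIV. if i = j then J $ k $ l * x $ (j, l) else 0)"
      unfolding matrix_vector_mult_def kronecker_product_def by (auto simp: mat_def intro!: sum.cong)
    also have "\<dots> = (\<Sum>l\<in>UNIV. \<Sum>j\<in>UNIV. if i = j then J $ k $ l * x $ (j, l) else 0)"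
      by (subst sum.swap) (simp only: sum.cartesian_product)
    finally show ?thesis
      by (simp add: uncoupled_field_def node_state_def matrix_vector_mult_def)
  qed
  then show ?thesis
    by (simp add: vec_eq_iff[of "_ *v _"])
qed

lemma network_field_has_derivative:
  fixes f :: "real^'d::finite \<Rightarrow> real^'d" and L :: "real^'n::finite^'n"
  assumes "(f has_derivative (*v) J) (at 0)"
  shows "(network_field f \<alpha> L has_derivative (*v) (network_jacobian J \<alpha> L)) (at 0)"
proof -
  have component: "((\<lambda>x. f (node_state x i) $ k) has_derivative (\<lambda>x. (J *v node_state x i) $ k)) (at 0)"
    for i :: 'n and k
  proof -
    have lin: "bounded_linear (\<lambda>x :: real^('n \<times> 'd). node_state x i)"
      using linear_node_state by (simp add: linear_conv_bounded_linear)
    have "((\<lambda>x. f (node_state x i)) has_derivative (\<lambda>x. J *v node_state x i)) (at 0)"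
      using has_derivative_compose[OF bounded_linear_imp_has_derivative[OF lin], of f "(*v) J" 0 UNIV] assms
      by (simp add: linear_0[OF linear_node_state])
    then show ?thesis
      by (rule bounded_linear.has_derivative[OF bounded_linear_vec_nth])
  qed
  have "(uncoupled_field f has_derivative uncoupled_field ((*v) J)) (at (0 :: real^('n \<times> 'd)))"
    by (rule has_derivative_componentwise_within[THEN iffD2, OF ballI])
      (use component in \<open>auto simp: Basis_vec_def inner_axis uncoupled_field_def\<close>)
  moreover have "((\<lambda>x. \<alpha> *\<^sub>R (kronecker_product L (mat 1 :: real^'d^'d) *v x)) has_derivative
      (\<lambda>x. \<alpha> *\<^sub>R (kronecker_product L (mat 1 :: real^'d^'d) *v x))) (at 0)"
    by (intro bounded_linear_imp_has_derivative bounded_linear_const_scaleR matrix_vector_mul_bounded_linear)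
  ultimately have "((\<lambda>x. uncoupled_field f x + \<alpha> *\<^sub>R (kronecker_product L (mat 1 :: real^'d^'d) *v x)) has_derivative
      (\<lambda>x. uncoupled_field ((*v) J) x + \<alpha> *\<^sub>R (kronecker_product L (mat 1) *v x))) (at 0)"
    by (rule has_derivative_add)
  moreover have "uncoupled_field ((*v) J) x + \<alpha> *\<^sub>R (kronecker_product L (mat 1) *v x) = network_jacobian J \<alpha> L *v x" for x
    by (simp add: network_jacobian_def matrix_vector_mult_add_rdistrib kronecker_identity_mult scaleR_matrix_vector_assoc)
  ultimately show ?thesis
    by (simp add: network_field_def[abs_def])
qed

lemma network_field_zero: "f 0 = 0 \<Longrightarrow> network_field f \<alpha> L 0 = 0"
  by (simp add: network_field_def uncoupled_field_def vec_eq_iff linear_0[OF linear_node_state])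

section \<open>The critical coupling parameter\<close>

theorem proposition5:
  fixes G :: "('n::finite, 'e) pre_digraph"
    and f :: "real^'d::finite \<Rightarrow> real^'d"
    and L :: "real^'n^'n"
  assumes "digraph G" and "verts G = UNIV" and "CARD('n) \<ge> 2"
    and "Digraph_Component.connected G"
    and "C1_field f" and "f 0 = 0"
    and "spectral_abscissa (jacobian f (at 0)) \<noteq> 0"
    and "L = laplacian_minus G \<or> L = laplacian_plus G"
    and "lyapunov_stable f 0"
  shows "\<exists>\<alpha>\<^sub>c>0.
    (\<forall>\<alpha>\<in>{..<\<alpha>\<^sub>c}. locally_exponentially_stable (network_field f \<alpha> L) 0) \<and>
    (\<forall>\<alpha>\<in>{\<alpha>\<^sub>c<..}. unstable (network_field f \<alpha> L) 0)"
proof -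
  define J where "J = jacobian f (at 0)"
  have f: "(f has_derivative (*v) J) (at 0)"
    using \<open>C1_field f\<close> unfolding C1_field_def differentiable_on_def J_def by (simp add: jacobian_works[symmetric])
  note eig_L = coupling_matrix_spectrum[OF assms(1-4) assms(8)]
  define \<nu>_max where "\<nu>_max = spectral_abscissa J"
  have "\<nu>_max \<in> Re ` eigenvalues J"
    unfolding \<nu>_max_def spectral_abscissa_def
    by (intro Max_in finite_imageI finite_eigenvalues) (simp add: eigenvalues_nonempty)
  then obtain \<nu> where \<nu>: "\<nu> \<in> eigenvalues J" "Re \<nu> = \<nu>_max"
    by auto
  have \<nu>_le: "Re \<nu>' \<le> \<nu>_max" if "\<nu>' \<in> eigenvalues J" for \<nu>'
    unfolding \<nu>_max_def spectral_abscissa_def using that by (simp add: finite_eigenvalues)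
  have \<nu>_neg: "\<nu>_max < 0"
  proof (rule ccontr)
    assume "\<not> \<nu>_max < 0"
    then have "0 < Re \<nu>"
      using assms(7) \<nu>(2) by (simp add: \<nu>_max_def J_def)
    then have "unstable f 0"
      by (rule unstable_if_eigenvalue_positive[OF f assms(6) \<nu>(1)])
    then show False
      using assms(9) by (simp add: unstable_def)
  qed
  define \<rho> where "\<rho> = spectral_abscissa L"
  have "\<rho> \<in> Re ` eigenvalues L"
    unfolding \<rho>_def spectral_abscissa_def
    by (intro Max_in finite_imageI finite_eigenvalues) (simp add: eigenvalues_nonempty)
  then obtain \<kappa> where \<kappa>: "\<kappa> \<in> eigenvalues L" "Re \<kappa> = \<rho>"
    by auto
  have \<kappa>_le: "Re \<kappa>' \<le> \<rho>" if "\<kappa>' \<in> eigenvalues L" for \<kappa>'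
    unfolding \<rho>_def spectral_abscissa_def using that by (simp add: finite_eigenvalues)
  obtain \<kappa>0 where "\<kappa>0 \<in> eigenvalues L" "0 < Re \<kappa>0"
    using eig_L(2) by blast
  then have \<rho>: "0 < \<rho>"
    using \<kappa>_le[of \<kappa>0] by linarith
  define \<alpha>\<^sub>c where "\<alpha>\<^sub>c = - \<nu>_max / \<rho>"
  have deriv: "(network_field f \<alpha> L has_derivative (*v) (network_jacobian J \<alpha> L)) (at 0)"
    and zero: "network_field f \<alpha> L 0 = 0" for \<alpha>
    using network_field_has_derivative[OF f] network_field_zero[of f, OF assms(6)] by auto
  have "locally_exponentially_stable (network_field f \<alpha> L) 0" if \<alpha>: "\<alpha> < \<alpha>\<^sub>c" for \<alpha>
  proof -
    obtain K where K: "K-lipschitz_on (cball 0 1) (network_field f \<alpha> L)"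
      using network_field_lipschitz[OF assms(5)] by blast
    show ?thesis
    proof (rule exponentially_stable_if_eigenvalues_negative[OF deriv zero K])
      fix \<mu> assume "\<mu> \<in> eigenvalues (network_jacobian J \<alpha> L)"
      then obtain \<nu>' \<kappa>' where \<mu>: "\<mu> = \<nu>' + of_real \<alpha> * \<kappa>'"
        and mem: "\<nu>' \<in> eigenvalues J" "\<kappa>' \<in> eigenvalues L"
        unfolding eigenvalues_network_jacobian by blast
      have "\<alpha> * Re \<kappa>' < - \<nu>_max"
      proof (cases "\<alpha> \<le> 0")
        case True
        then have "\<alpha> * Re \<kappa>' \<le> 0"
          using eig_L(1)[OF mem(2)] by (rule mult_nonpos_nonneg)
        then show ?thesis
          using \<nu>_neg by linarith
      next
        case False
        then have "\<alpha> * Re \<kappa>' \<le> \<alpha> * \<rho>"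
          using \<kappa>_le[OF mem(2)] by (intro mult_left_mono) auto
        also have "\<dots> < - \<nu>_max"
          using \<alpha> \<rho> by (simp add: \<alpha>\<^sub>c_def field_simps)
        finally show ?thesis .
      qed
      then show "Re \<mu> < 0"
        using \<nu>_le[OF mem(1)] by (simp add: \<mu>)
    qed simp
  qed
  moreover have "unstable (network_field f \<alpha> L) 0" if \<alpha>: "\<alpha>\<^sub>c < \<alpha>" for \<alpha>
  proof (rule unstable_if_eigenvalue_positive[OF deriv zero])
    show "\<nu> + of_real \<alpha> * \<kappa> \<in> eigenvalues (network_jacobian J \<alpha> L)"
      unfolding eigenvalues_network_jacobian using \<nu>(1) \<kappa>(1) by blast
    show "0 < Re (\<nu> + of_real \<alpha> * \<kappa>)"
      using \<alpha> \<rho> by (simp add: \<nu>(2) \<kappa>(2) \<alpha>\<^sub>c_def field_simps)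
  qed
  moreover have "0 < \<alpha>\<^sub>c"
    unfolding \<alpha>\<^sub>c_def using \<nu>_neg \<rho> by (intro divide_pos_pos) auto
  ultimately show ?thesis
    by (intro exI[of _ \<alpha>\<^sub>c] conjI ballI) (simp_all only: lessThan_iff greaterThan_iff)
qed

end
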